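(* There exist (i) a free algebra $\mathcal{S} \subset \mathbb{R}^{\mathbb{R}}$ with $2^{\mathfrak{c}}$ free generators such that for every $r \in \mathcal{S}$ and every compact interval $[\alpha,\beta] \subset \mathbb{R}$ the restriction $r|_{[\alpha,\beta]}$ is Riemann integrable, and (ii) a free algebra $\mathcal{C} \subset \mathbb{R}^{[0,1]}$ with $\mathfrak{c}$ free generators, all of whose elements are continuous functions on $[0,1]$, such that for every $r \in \mathcal{S}\setminus\{0\}$ and every $c \in \mathcal{C}\setminus\{0\}$ the composite function $r \circ c : [0,1] \to \mathbb{R}$ is not Riemann integrable on $[0,1]$.
   Context: $\mathfrak{c}$ denotes the cardinality of the continuum. For a set $X$, $\mathbb{R}^X$ is the commutative real algebra of all functions $X \to \mathbb{R}$ with pointwise operations. Algebras here are not required to contain the constant functions (no unit is assumed). For a cardinal $\alpha$, a subalgebra $M \subset \mathbb{R}^X$ is a free algebra with $\alpha$ free generators (an $\alpha$-generated free algebra) if there is a set $B \subset M$ of cardinality $\alpha$ such that $M$ is the set of all functions $P(f_1,\dots,f_N)$, where $N \in \mathbb{N}$, $f_1,\dots,f_N \in B$ are distinct and $P$ is a real polynomial in $N$ variables without constant term, and such that $P(f_1,\dots,f_N) \neq 0$ (i.e. is not the identically zero function) whenever $P$ is a nonzero real polynomial in $N$ variables without constant term and $f_1,\dots,f_N \in B$ are distinct. *)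

theory Defs
  imports
    "HOL-Analysis.Analysis"
    "HOL-Library.Poly_Mapping"
    "HOL-Library.Equipollence"
begin

text \<open>The algebra of all real functions on a set \<open>X\<close> is represented by \<open>extensional X\<close>, so that
  two functions are equal iff they agree on \<open>X\<close>; all operations are restricted to \<open>X\<close>.
  For \<open>X = UNIV\<close> this is the full function space.\<close>

definition function_subalgebra :: "'a set \<Rightarrow> ('a \<Rightarrow> real) set \<Rightarrow> bool" where
  "function_subalgebra X M \<longleftrightarrow>
     M \<subseteq> extensional X \<and>
     (\<lambda>x\<in>X. 0) \<in> M \<and>
     (\<forall>f\<in>M. \<forall>g\<in>M. (\<lambda>x\<in>X. f x + g x) \<in> M) \<and>
     (\<forall>f\<in>M. \<forall>g\<in>M. (\<lambda>x\<in>X. f x * g x) \<in> M) \<and>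
     (\<forall>a. \<forall>f\<in>M. (\<lambda>x\<in>X. a * f x) \<in> M)"

text \<open>A multivariate polynomial is a finitely supported map from exponent vectors to coefficients;
  its variables are numbered from \<open>0\<close>.  The exponent vector \<open>0\<close> belongs to the constant term.\<close>

type_synonym real_mpoly = "(nat \<Rightarrow>\<^sub>0 nat) \<Rightarrow>\<^sub>0 real"

definition mpolys_no_const :: "nat \<Rightarrow> real_mpoly set" where
  "mpolys_no_const N =
     {P. (\<forall>m \<in> Poly_Mapping.keys P. Poly_Mapping.keys m \<subseteq> {..<N}) \<and> Poly_Mapping.lookup P 0 = 0}"

definition mpoly_eval :: "real_mpoly \<Rightarrow> (nat \<Rightarrow> real) \<Rightarrow> real" where
  "mpoly_eval P v =
     (\<Sum>m \<in> Poly_Mapping.keys P.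
        Poly_Mapping.lookup P m * (\<Prod>i \<in> Poly_Mapping.keys m. v i ^ Poly_Mapping.lookup m i))"

definition mpoly_of_functions :: "'a set \<Rightarrow> real_mpoly \<Rightarrow> (nat \<Rightarrow> 'a \<Rightarrow> real) \<Rightarrow> 'a \<Rightarrow> real" where
  "mpoly_of_functions X P f = (\<lambda>x\<in>X. mpoly_eval P (\<lambda>i. f i x))"

text \<open>The number of free generators is given as the cardinality of the set \<open>A\<close>.\<close>

definition free_function_algebra :: "'a set \<Rightarrow> 'b set \<Rightarrow> ('a \<Rightarrow> real) set \<Rightarrow> bool" where
  "free_function_algebra X A M \<longleftrightarrow>
     function_subalgebra X M \<and>
     (\<exists>B. B \<subseteq> M \<and> B \<approx> A \<and>
        M = {mpoly_of_functions X P f | N P f.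
               P \<in> mpolys_no_const N \<and> f ` {..<N} \<subseteq> B \<and> inj_on f {..<N}} \<and>
        (\<forall>N P f. P \<in> mpolys_no_const N \<and> P \<noteq> 0 \<and> f ` {..<N} \<subseteq> B \<and> inj_on f {..<N}
           \<longrightarrow> mpoly_of_functions X P f \<noteq> (\<lambda>x\<in>X. 0)))"

text \<open>Convergence of the Riemann sums as the mesh tends to \<open>0\<close>, for \<open>a \<le> b\<close>.  This is not the library's
  \<open>integrable_on\<close>, which is the strictly weaker Henstock-Kurzweil integrability.\<close>

definition riemann_integrable :: "(real \<Rightarrow> real) \<Rightarrow> real \<Rightarrow> real \<Rightarrow> bool" where
  "riemann_integrable f a b \<longleftrightarrow>
     (\<exists>I. \<forall>\<epsilon>>0. \<exists>\<delta>>0. \<forall>p.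
        p tagged_division_of {a..b} \<and> (\<forall>(x, K)\<in>p. measure lborel K < \<delta>)
        \<longrightarrow> \<bar>(\<Sum>(x, K)\<in>p. measure lborel K * f x) - I\<bar> < \<epsilon>)"

end

theory Submission
  imports Defs "HOL-Real_Asymp.Real_Asymp"
begin

text \<open>The two algebras interact only at the value \<open>0\<close>.  Fix a closed set \<open>E\<close> of positive measure in
  \<open>{0..1}\<close> that contains no rational number, hence has empty interior.

  Every generator of \<open>C\<close> is \<open>\<lambda>x. \<phi> (infdist x E)\<close> with \<open>\<phi> s = exp (- s powr - p)\<close> for an exponent \<open>p > 0\<close>
  that identifies the generator.  As \<open>s\<close> tends to \<open>0\<close>, distinct monomials in these \<open>\<phi>\<close> differ by a factor
  that tends to \<open>0\<close> or to infinity, so a nonzero polynomial in them behaves like its dominant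
  monomial and has no zeros at small \<open>s > 0\<close> (\<open>flat_exp_independent\<close>).  This gives freeness.  It also shows that
  a nonzero \<open>c\<close> in \<open>C\<close> vanishes on \<open>E\<close> but on no neighbourhood of a point of \<open>E\<close>; by the
  intermediate value theorem \<open>c\<close> then maps each such neighbourhood onto a set containing an
  interval \<open>{0..m}\<close> or \<open>{m..0}\<close> with \<open>m \<noteq> 0\<close>.

  Every element of \<open>S\<close> is bounded and vanishes off one closed null set \<open>Z\<close>, and is
  therefore Riemann integrable (\<open>riemann_integrable_zero_off_closed_null\<close>).  The generators moreover
  repeat, simultaneously, each of their nonzero patterns of values arbitrarily close to \<open>0\<close> on both sides
  (\<open>ex_recurrent_interpolating_family\<close>), and this passes to polynomials in them: if \<open>r y0 = a \<noteq> 0\<close>,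
  then \<open>r\<close> takes the value \<open>a\<close>, and off \<open>Z\<close> also the value \<open>0\<close>, in every interval \<open>{0..m}\<close> or \<open>{m..0}\<close>.

  So \<open>r \<circ> c\<close> takes both values \<open>a\<close> and \<open>0\<close> near each point of \<open>E\<close>
  (\<open>composite_oscillates\<close>), and two Riemann sums of \<open>r \<circ> c\<close> over the same fine partition can differ by
  at least \<open>\<bar>a\<bar>\<close> times the measure of \<open>E\<close> (\<open>oscillating_not_riemann_integrable\<close>).  That the
  oscillation is placed at \<open>0\<close> is forced: \<open>C\<close> is closed under scaling, and by Fubini's theorem
  almost every multiple of \<open>c\<close> meets the null set of discontinuities of \<open>r\<close> only in a null set of
  arguments, apart from the zeros of \<open>c\<close>.

  The \<open>2\<close>-to-the-continuum many generators of \<open>S\<close> come from the Fichtenholz-Kantorovich construction of an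
  independent family: each set of reals is a generator, and a sequence of reals encodes finitely
  many test points together with values prescribed for the patterns of membership in them.  Such
  sequences are placed on a Cantor set, where a code, marked by a first nonzero digit, may be preceded
  by any number of zero digits; this is what makes the values recur near \<open>0\<close>.\<close>

section \<open>Evaluation of polynomials\<close>

definition monomial_value :: "(nat \<Rightarrow>\<^sub>0 nat) \<Rightarrow> (nat \<Rightarrow> real) \<Rightarrow> real" where
  "monomial_value m v = (\<Prod>i \<in> Poly_Mapping.keys m. v i ^ Poly_Mapping.lookup m i)"

lemma monomial_value_superset:
  assumes "finite A" "Poly_Mapping.keys m \<subseteq> A"
  shows "monomial_value m v = (\<Prod>i\<in>A. v i ^ Poly_Mapping.lookup m i)"
  unfolding monomial_value_def
  by (rule prod.mono_neutral_left) (use assms in \<open>auto simp: in_keys_iff\<close>)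

lemma monomial_value_add:
  "monomial_value (m + m') v = monomial_value m v * monomial_value m' v"
proof -
  let ?A = "Poly_Mapping.keys m \<union> Poly_Mapping.keys m'"
  have "monomial_value (m + m') v = (\<Prod>i\<in>?A. v i ^ Poly_Mapping.lookup (m + m') i)"
    by (rule monomial_value_superset) (rule finite_UnI keys_add | simp add: keys_add)+
  also have "\<dots> = (\<Prod>i\<in>?A. v i ^ Poly_Mapping.lookup m i) * (\<Prod>i\<in>?A. v i ^ Poly_Mapping.lookup m' i)"
    by (simp add: lookup_add power_add prod.distrib)
  also have "\<dots> = monomial_value m v * monomial_value m' v"
    by (simp add: monomial_value_superset[of ?A])
  finally show ?thesis .
qed

lemma mpoly_eval_superset:
  assumes "finite A" "Poly_Mapping.keys P \<subseteq> A"
  shows "mpoly_eval P v = (\<Sum>m\<in>A. Poly_Mapping.lookup P m * monomial_value m v)"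
  unfolding mpoly_eval_def monomial_value_def[symmetric]
  by (rule sum.mono_neutral_left) (use assms in \<open>auto simp: in_keys_iff\<close>)

lemma mpoly_eval_add: "mpoly_eval (P + Q) v = mpoly_eval P v + mpoly_eval Q v"
proof -
  let ?A = "Poly_Mapping.keys P \<union> Poly_Mapping.keys Q"
  have "mpoly_eval (P + Q) v = (\<Sum>m\<in>?A. Poly_Mapping.lookup (P + Q) m * monomial_value m v)"
    by (rule mpoly_eval_superset) (rule finite_UnI keys_add | simp add: keys_add)+
  also have "\<dots> = mpoly_eval P v + mpoly_eval Q v"
    by (simp add: mpoly_eval_superset[of ?A] lookup_add distrib_right sum.distrib)
  finally show ?thesis .
qed

lemma mpoly_eval_single: "mpoly_eval (Poly_Mapping.single m a) v = a * monomial_value m v"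
  by (simp add: mpoly_eval_superset[of "{m}"])

lemma mpoly_eval_zero [simp]: "mpoly_eval 0 v = 0"
  by (simp add: mpoly_eval_def)

lemma mpolys_no_const_add:
  "P \<in> mpolys_no_const N \<Longrightarrow> Q \<in> mpolys_no_const N \<Longrightarrow> P + Q \<in> mpolys_no_const N"
  using keys_add[of P Q] by (auto simp: mpolys_no_const_def lookup_add)

lemma mpolys_no_const_single:
  assumes "m \<noteq> 0" "Poly_Mapping.keys m \<subseteq> {..<N}"
  shows "Poly_Mapping.single m a \<in> mpolys_no_const N"
  using assms by (auto simp: mpolys_no_const_def lookup_single)

lemma keys_nonempty: "(m :: nat \<Rightarrow>\<^sub>0 nat) \<noteq> 0 \<Longrightarrow> Poly_Mapping.keys m \<noteq> {}"
  by (auto intro!: poly_mapping_eqI simp: in_keys_iff set_eq_iff)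

lemma no_const_keys:
  assumes "P \<in> mpolys_no_const N" "m \<in> Poly_Mapping.keys P"
  shows "m \<noteq> 0" "Poly_Mapping.keys m \<subseteq> {..<N}" "Poly_Mapping.keys m \<noteq> {}"
proof -
  show "m \<noteq> 0" using assms by (auto simp: mpolys_no_const_def in_keys_iff)
  then show "Poly_Mapping.keys m \<noteq> {}" by (rule keys_nonempty)
  show "Poly_Mapping.keys m \<subseteq> {..<N}" using assms by (auto simp: mpolys_no_const_def)
qed

lemma mpoly_eval_cong:
  assumes "P \<in> mpolys_no_const N" "\<And>i. i < N \<Longrightarrow> v i = w i"
  shows "mpoly_eval P v = mpoly_eval P w"
  unfolding mpoly_eval_def
  using no_const_keys(2)[OF assms(1)] assms(2)
  by (intro sum.cong refl arg_cong2[where f = "(*)"] prod.cong) (auto simp: subset_iff)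

lemma mpoly_eval_zero_arguments:
  assumes "P \<in> mpolys_no_const N" "\<And>i. i < N \<Longrightarrow> v i = 0"
  shows "mpoly_eval P v = 0"
  unfolding mpoly_eval_def
proof (rule sum.neutral, rule ballI)
  fix m assume m: "m \<in> Poly_Mapping.keys P"
  obtain i where i: "i \<in> Poly_Mapping.keys m" using no_const_keys(3)[OF assms(1) m] by blast
  then have "v i ^ Poly_Mapping.lookup m i = 0"
    using assms(2) no_const_keys(2)[OF assms(1) m] by (auto simp: in_keys_iff subset_iff)
  then show "Poly_Mapping.lookup P m * (\<Prod>i\<in>Poly_Mapping.keys m. v i ^ Poly_Mapping.lookup m i) = 0"
    using i by auto
qed

lemma mpoly_eval_bound:
  assumes "P \<in> mpolys_no_const N" "\<And>i. i < N \<Longrightarrow> \<bar>v i\<bar> \<le> 1"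
  shows "\<bar>mpoly_eval P v\<bar> \<le> (\<Sum>m\<in>Poly_Mapping.keys P. \<bar>Poly_Mapping.lookup P m\<bar>)"
  unfolding mpoly_eval_def
proof (rule order_trans[OF sum_abs sum_mono])
  fix m assume m: "m \<in> Poly_Mapping.keys P"
  have "(\<Prod>i\<in>Poly_Mapping.keys m. \<bar>v i\<bar> ^ Poly_Mapping.lookup m i) \<le> 1"
    using assms(2) no_const_keys(2)[OF assms(1) m] by (intro prod_le_1) (auto simp: power_le_one subset_iff)
  then show "\<bar>Poly_Mapping.lookup P m * (\<Prod>i\<in>Poly_Mapping.keys m. v i ^ Poly_Mapping.lookup m i)\<bar>
      \<le> \<bar>Poly_Mapping.lookup P m\<bar>"
    by (simp add: abs_mult abs_prod power_abs mult_left_le)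
qed

lemma continuous_on_mpoly_eval:
  assumes "P \<in> mpolys_no_const N" "\<And>i. i < N \<Longrightarrow> continuous_on X (f i)"
  shows "continuous_on X (\<lambda>x. mpoly_eval P (\<lambda>i. f i x))"
  unfolding mpoly_eval_def
proof (intro continuous_on_sum continuous_on_mult continuous_on_const continuous_on_prod continuous_on_power)
  fix m i assume "m \<in> Poly_Mapping.keys P" "i \<in> Poly_Mapping.keys m"
  then show "continuous_on X (f i)"
    using no_const_keys(2)[OF assms(1)] assms(2) by blast
qed

section \<open>The algebra generated by a set of functions\<close>

lemma function_subalgebraD:
  assumes "function_subalgebra X V"
  shows "f \<in> V \<Longrightarrow> g \<in> V \<Longrightarrow> (\<lambda>x\<in>X. f x + g x) \<in> V"
    and "f \<in> V \<Longrightarrow> g \<in> V \<Longrightarrow> (\<lambda>x\<in>X. f x * g x) \<in> V"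
    and "f \<in> V \<Longrightarrow> (\<lambda>x\<in>X. a * f x) \<in> V"
  using assms by (auto simp: function_subalgebra_def)

lemma subalgebra_sum:
  assumes V: "function_subalgebra X V" and "finite A" "\<And>i. i \<in> A \<Longrightarrow> (\<lambda>x\<in>X. g i x) \<in> V"
  shows "(\<lambda>x\<in>X. \<Sum>i\<in>A. g i x) \<in> V"
  using assms(2,3)
proof (induction A rule: finite_induct)
  case empty
  have "(\<lambda>x\<in>X. 0) \<in> V" using V unfolding function_subalgebra_def by blast
  then show ?case by (simp only: sum.empty)
next
  case (insert i A)
  then have "(\<lambda>x\<in>X. (\<lambda>x\<in>X. g i x) x + (\<lambda>x\<in>X. \<Sum>i\<in>A. g i x) x) \<in> V"
    using V unfolding function_subalgebra_def by blast
  also have "(\<lambda>x\<in>X. (\<lambda>x\<in>X. g i x) x + (\<lambda>x\<in>X. \<Sum>i\<in>A. g i x) x) = (\<lambda>x\<in>X. \<Sum>i\<in>insert i A. g i x)"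
    using insert by (auto simp: fun_eq_iff)
  finally show ?case .
qed

text \<open>The index set has to be nonempty because the constant function \<open>1\<close> may be missing.\<close>

lemma subalgebra_prod:
  assumes V: "function_subalgebra X V" and "finite A" "A \<noteq> {}" "\<And>i. i \<in> A \<Longrightarrow> (\<lambda>x\<in>X. g i x) \<in> V"
  shows "(\<lambda>x\<in>X. \<Prod>i\<in>A. g i x) \<in> V"
  using assms(2-4)
proof (induction A rule: finite_ne_induct)
  case (singleton i)
  then show ?case by simp
next
  case (insert i A)
  then have "(\<lambda>x\<in>X. (\<lambda>x\<in>X. g i x) x * (\<lambda>x\<in>X. \<Prod>i\<in>A. g i x) x) \<in> V"
    using V unfolding function_subalgebra_def by blast
  also have "(\<lambda>x\<in>X. (\<lambda>x\<in>X. g i x) x * (\<lambda>x\<in>X. \<Prod>i\<in>A. g i x) x) = (\<lambda>x\<in>X. \<Prod>i\<in>insert i A. g i x)"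
    using insert by (auto simp: fun_eq_iff)
  finally show ?case .
qed

lemma subalgebra_power:
  assumes V: "function_subalgebra X V" and "f \<in> V" "n > 0"
  shows "(\<lambda>x\<in>X. f x ^ n) \<in> V"
proof -
  have "(\<lambda>x\<in>X. f x) = f"
    using assms by (auto simp: function_subalgebra_def extensional_def fun_eq_iff)
  then have "(\<lambda>x\<in>X. \<Prod>i<n. f x) \<in> V"
    using assms by (intro subalgebra_prod) auto
  then show ?thesis by simp
qed

lemma subalgebra_mpoly:
  assumes V: "function_subalgebra X V" and P: "P \<in> mpolys_no_const N" and f: "\<And>i. i < N \<Longrightarrow> f i \<in> V"
  shows "mpoly_of_functions X P f \<in> V"
  unfolding mpoly_of_functions_def mpoly_eval_def
proof (intro subalgebra_sum[OF V])
  fix m assume m: "m \<in> Poly_Mapping.keys P"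
  have "(\<lambda>x\<in>X. \<Prod>i\<in>Poly_Mapping.keys m. f i x ^ Poly_Mapping.lookup m i) \<in> V" (is "?q \<in> V")
    using no_const_keys[OF P m] f
    by (intro subalgebra_prod[OF V] subalgebra_power[OF V]) (auto simp flip: neq0_conv in_keys_iff)
  then have "(\<lambda>x\<in>X. Poly_Mapping.lookup P m * ?q x) \<in> V"
    using V unfolding function_subalgebra_def by blast
  moreover have "(\<lambda>x\<in>X. Poly_Mapping.lookup P m * ?q x) = (\<lambda>x\<in>X. Poly_Mapping.lookup P m *
     (\<Prod>i\<in>Poly_Mapping.keys m. f i x ^ Poly_Mapping.lookup m i))"
    by (auto simp: fun_eq_iff)
  ultimately show "(\<lambda>x\<in>X. Poly_Mapping.lookup P m *
     (\<Prod>i\<in>Poly_Mapping.keys m. f i x ^ Poly_Mapping.lookup m i)) \<in> V"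
    by simp
qed auto

text \<open>The evaluation maps of polynomials, with the polynomials themselves forgotten.  Sums and
  products of polynomials need only be found up to evaluation, which avoids all computations with
  coefficients of products.\<close>

definition polynomial_maps :: "nat \<Rightarrow> ((nat \<Rightarrow> real) \<Rightarrow> real) set" where
  "polynomial_maps N = mpoly_eval ` mpolys_no_const N"

lemma polynomial_maps_add:
  assumes "F \<in> polynomial_maps N" "G \<in> polynomial_maps N"
  shows "(\<lambda>v. F v + G v) \<in> polynomial_maps N"
  using assms mpolys_no_const_add
  by (auto simp: polynomial_maps_def image_iff fun_eq_iff mpoly_eval_add[symmetric])

lemma polynomial_maps_monomial:
  assumes "m \<noteq> 0" "Poly_Mapping.keys m \<subseteq> {..<N}"
  shows "(\<lambda>v. a * monomial_value m v) \<in> polynomial_maps N"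
  unfolding polynomial_maps_def image_iff
  by (rule bexI[OF _ mpolys_no_const_single[OF assms, of a]]) (simp add: mpoly_eval_single fun_eq_iff)

lemma polynomial_maps_zero: "(\<lambda>v. 0) \<in> polynomial_maps N"
  unfolding polynomial_maps_def image_iff
  by (rule bexI[of _ 0]) (auto simp: mpolys_no_const_def)

lemma polynomial_maps_sum:
  assumes "finite A" "\<And>i. i \<in> A \<Longrightarrow> F i \<in> polynomial_maps N"
  shows "(\<lambda>v. \<Sum>i\<in>A. F i v) \<in> polynomial_maps N"
  using assms by (induction A rule: finite_induct) (auto simp: polynomial_maps_zero polynomial_maps_add)

lemma function_subalgebra_polynomial_maps: "function_subalgebra UNIV (polynomial_maps N)"
  unfolding function_subalgebra_def
proof (intro conjI ballI allI)
  show "polynomial_maps N \<subseteq> extensional UNIV" by (simp add: extensional_def)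
  show "(\<lambda>x\<in>UNIV. 0) \<in> polynomial_maps N" by (simp add: restrict_UNIV polynomial_maps_zero)
next
  fix F G assume FG: "F \<in> polynomial_maps N" "G \<in> polynomial_maps N"
  then show "(\<lambda>x\<in>UNIV. F x + G x) \<in> polynomial_maps N"
    by (simp add: restrict_UNIV polynomial_maps_add)
  obtain P Q where P: "P \<in> mpolys_no_const N" "F = mpoly_eval P"
    and Q: "Q \<in> mpolys_no_const N" "G = mpoly_eval Q"
    using FG by (auto simp: polynomial_maps_def)
  have "(\<lambda>v. \<Sum>m\<in>Poly_Mapping.keys P. \<Sum>m'\<in>Poly_Mapping.keys Q.
           (Poly_Mapping.lookup P m * Poly_Mapping.lookup Q m') * monomial_value (m + m') v)
        \<in> polynomial_maps N"
  proof (intro polynomial_maps_sum polynomial_maps_monomial)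
    fix m m' assume m: "m \<in> Poly_Mapping.keys P" "m' \<in> Poly_Mapping.keys Q"
    show "Poly_Mapping.keys (m + m') \<subseteq> {..<N}"
      using keys_add[of m m'] no_const_keys(2)[OF P(1) m(1)] no_const_keys(2)[OF Q(1) m(2)] by blast
    show "m + m' \<noteq> 0"
      using no_const_keys(1)[OF P(1) m(1)]
      by (auto simp: poly_mapping_eq_iff fun_eq_iff lookup_add)
  qed auto
  also have "(\<lambda>v. \<Sum>m\<in>Poly_Mapping.keys P. \<Sum>m'\<in>Poly_Mapping.keys Q.
           (Poly_Mapping.lookup P m * Poly_Mapping.lookup Q m') * monomial_value (m + m') v)
      = (\<lambda>v. F v * G v)"
    unfolding P Q mpoly_eval_def monomial_value_def[symmetric]
    by (simp add: fun_eq_iff sum_product monomial_value_add mult_ac)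
  finally show "(\<lambda>x\<in>UNIV. F x * G x) \<in> polynomial_maps N"
    by (simp add: restrict_UNIV)
next
  fix a F assume "F \<in> polynomial_maps N"
  then obtain P where P: "P \<in> mpolys_no_const N" "F = mpoly_eval P"
    by (auto simp: polynomial_maps_def)
  have "(\<lambda>v. \<Sum>m\<in>Poly_Mapping.keys P. (a * Poly_Mapping.lookup P m) * monomial_value m v)
        \<in> polynomial_maps N"
    using no_const_keys[OF P(1)] by (intro polynomial_maps_sum polynomial_maps_monomial) auto
  also have "(\<lambda>v. \<Sum>m\<in>Poly_Mapping.keys P. (a * Poly_Mapping.lookup P m) * monomial_value m v)
      = (\<lambda>v. a * F v)"
    unfolding P mpoly_eval_def monomial_value_def[symmetric]
    by (simp add: fun_eq_iff sum_distrib_left mult_ac)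
  finally show "(\<lambda>x\<in>UNIV. a * F x) \<in> polynomial_maps N"
    by (simp add: restrict_UNIV)
qed

lemma coordinate_polynomial_map: "i < N \<Longrightarrow> (\<lambda>v. v i) \<in> polynomial_maps N"
proof -
  assume i: "i < N"
  have "Poly_Mapping.lookup (Poly_Mapping.single i (1::nat)) i \<noteq> Poly_Mapping.lookup 0 i"
    by simp
  then have "Poly_Mapping.single i (1::nat) \<noteq> 0"
    by metis
  from polynomial_maps_monomial[OF this, of N 1] i show ?thesis
    by (simp add: monomial_value_def)
qed

text \<open>Substituting variables for variables amounts to evaluating the polynomial at coordinate functions,
  and these belong to the algebra of polynomial maps.\<close>

lemma mpoly_rename_variables:
  assumes "P \<in> mpolys_no_const N" "\<And>i. i < N \<Longrightarrow> \<sigma> i < L"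
  obtains Q where "Q \<in> mpolys_no_const L" "\<And>v. mpoly_eval Q v = mpoly_eval P (\<lambda>i. v (\<sigma> i))"
proof -
  have "mpoly_of_functions UNIV P (\<lambda>i v. v (\<sigma> i)) \<in> polynomial_maps L"
    using assms(2)
    by (intro subalgebra_mpoly[OF function_subalgebra_polynomial_maps assms(1)] coordinate_polynomial_map)
  then show ?thesis
    using that by (auto simp: polynomial_maps_def mpoly_of_functions_def restrict_UNIV fun_eq_iff)
qed

definition polynomial_algebra :: "'a set \<Rightarrow> ('a \<Rightarrow> real) set \<Rightarrow> ('a \<Rightarrow> real) set" where
  "polynomial_algebra X B =
     {mpoly_of_functions X P f | N P f.
        P \<in> mpolys_no_const N \<and> f ` {..<N} \<subseteq> B \<and> inj_on f {..<N}}"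

text \<open>Two elements may be written with different lists of generators that overlap.  Only after both
  are rewritten over one list without repetitions can they be added or multiplied as polynomials.\<close>

lemma polynomial_algebra_common_generators:
  assumes "p \<in> polynomial_algebra X B" "q \<in> polynomial_algebra X B"
  obtains L h P Q where "h ` {..<L} \<subseteq> B" "inj_on h {..<L}"
    "P \<in> mpolys_no_const L" "p = mpoly_of_functions X P h"
    "Q \<in> mpolys_no_const L" "q = mpoly_of_functions X Q h"
proof -
  obtain N P f where P: "P \<in> mpolys_no_const N" "f ` {..<N} \<subseteq> B" "p = mpoly_of_functions X P f"
    using assms(1) by (auto simp: polynomial_algebra_def)
  obtain M Q g where Q: "Q \<in> mpolys_no_const M" "g ` {..<M} \<subseteq> B" "q = mpoly_of_functions X Q g"
    using assms(2) by (auto simp: polynomial_algebra_def)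
  let ?D = "f ` {..<N} \<union> g ` {..<M}"
  obtain h where h: "bij_betw h {..<card ?D} ?D"
    using ex_bij_betw_nat_finite[of ?D] by (auto simp: atLeast0LessThan)
  have rename: "\<exists>R \<in> mpolys_no_const (card ?D). mpoly_of_functions X P' f' = mpoly_of_functions X R h"
    if P': "P' \<in> mpolys_no_const N'" and f': "f' ` {..<N'} \<subseteq> ?D" for P' N' f'
  proof -
    have "\<exists>j<card ?D. h j = f' i" if "i < N'" for i
    proof -
      have "h ` {..<card ?D} = ?D" using h by (rule bij_betw_imp_surj_on)
      moreover have "f' i \<in> ?D" using f' that by blast
      ultimately show ?thesis by (metis (no_types, lifting) imageE lessThan_iff)
    qed
    then obtain \<sigma> where \<sigma>: "\<And>i. i < N' \<Longrightarrow> \<sigma> i < card ?D" "\<And>i. i < N' \<Longrightarrow> h (\<sigma> i) = f' i"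
      by metis
    obtain R where R: "R \<in> mpolys_no_const (card ?D)" "\<And>v. mpoly_eval R v = mpoly_eval P' (\<lambda>i. v (\<sigma> i))"
      by (rule mpoly_rename_variables[OF P' \<sigma>(1)]) auto
    have "mpoly_of_functions X P' f' = mpoly_of_functions X R h"
      unfolding mpoly_of_functions_def R(2)
      by (intro restrict_ext mpoly_eval_cong[OF P']) (simp add: \<sigma>)
    then show ?thesis using R(1) by blast
  qed
  obtain P' where P': "P' \<in> mpolys_no_const (card ?D)" "p = mpoly_of_functions X P' h"
    using rename[OF P(1), of f] P(3) by blast
  obtain Q' where Q': "Q' \<in> mpolys_no_const (card ?D)" "q = mpoly_of_functions X Q' h"
    using rename[OF Q(1), of g] Q(3) by blast
  have "h ` {..<card ?D} \<subseteq> B"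
    using h P(2) Q(2) by (simp only: bij_betw_imp_surj_on) blast
  then show ?thesis
    using bij_betw_imp_inj_on[OF h] P' Q' by (rule that)
qed

lemma polynomial_algebraI:
  assumes "F \<in> polynomial_maps L" "h ` {..<L} \<subseteq> B" "inj_on h {..<L}"
  shows "(\<lambda>x\<in>X. F (\<lambda>i. h i x)) \<in> polynomial_algebra X B"
  using assms by (auto simp: polynomial_maps_def polynomial_algebra_def mpoly_of_functions_def)

lemma function_subalgebra_polynomial_algebra: "function_subalgebra X (polynomial_algebra X B)"
proof -
  have closed: "(\<lambda>x\<in>X. p x + q x) \<in> polynomial_algebra X B"
    "(\<lambda>x\<in>X. p x * q x) \<in> polynomial_algebra X B"
    "(\<lambda>x\<in>X. a * p x) \<in> polynomial_algebra X B"
    if pq: "p \<in> polynomial_algebra X B" "q \<in> polynomial_algebra X B" for p q a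
  proof -
    obtain L h P Q where *: "h ` {..<L} \<subseteq> B" "inj_on h {..<L}"
      and P: "P \<in> mpolys_no_const L" "p = mpoly_of_functions X P h"
      and Q: "Q \<in> mpolys_no_const L" "q = mpoly_of_functions X Q h"
      by (rule polynomial_algebra_common_generators[OF pq])
    have "(\<lambda>v. mpoly_eval P v + mpoly_eval Q v) \<in> polynomial_maps L"
      "(\<lambda>v. mpoly_eval P v * mpoly_eval Q v) \<in> polynomial_maps L"
      "(\<lambda>v. a * mpoly_eval P v) \<in> polynomial_maps L"
      using function_subalgebraD[OF function_subalgebra_polynomial_maps] P(1) Q(1)
      by (simp_all add: polynomial_maps_def restrict_UNIV)
    from this[THEN polynomial_algebraI, OF *, of X]
    have "(\<lambda>x\<in>X. mpoly_eval P (\<lambda>i. h i x) + mpoly_eval Q (\<lambda>i. h i x)) \<in> polynomial_algebra X B"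
      "(\<lambda>x\<in>X. mpoly_eval P (\<lambda>i. h i x) * mpoly_eval Q (\<lambda>i. h i x)) \<in> polynomial_algebra X B"
      "(\<lambda>x\<in>X. a * mpoly_eval P (\<lambda>i. h i x)) \<in> polynomial_algebra X B" .
    moreover have "p x = mpoly_eval P (\<lambda>i. h i x)" "q x = mpoly_eval Q (\<lambda>i. h i x)" if "x \<in> X" for x
      using that by (simp_all add: P(2) Q(2) mpoly_of_functions_def)
    ultimately show "(\<lambda>x\<in>X. p x + q x) \<in> polynomial_algebra X B"
      "(\<lambda>x\<in>X. p x * q x) \<in> polynomial_algebra X B"
      "(\<lambda>x\<in>X. a * p x) \<in> polynomial_algebra X B"
      by (simp_all cong: restrict_cong)
  qed
  moreover have "(\<lambda>x\<in>X. 0) \<in> polynomial_algebra X B"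
    using polynomial_algebraI[OF polynomial_maps_zero[of 0], of "\<lambda>_ _. 0" B X] by simp
  moreover have "polynomial_algebra X B \<subseteq> extensional X"
    by (auto simp: polynomial_algebra_def mpoly_of_functions_def)
  ultimately show ?thesis
    unfolding function_subalgebra_def by auto
qed

text \<open>Freeness is reduced to independence: every nonzero polynomial in distinct generators has a
  point where it does not vanish.\<close>

lemma free_function_algebra_polynomial_algebra:
  assumes "inj_on G A" "G ` A \<subseteq> extensional X"
    and indep: "\<And>N P t. P \<in> mpolys_no_const N \<Longrightarrow> P \<noteq> 0 \<Longrightarrow> t ` {..<N} \<subseteq> A \<Longrightarrow> inj_on t {..<N} \<Longrightarrow>
         \<exists>x\<in>X. mpoly_eval P (\<lambda>i. G (t i) x) \<noteq> 0"
  shows "free_function_algebra X A (polynomial_algebra X (G ` A))"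
proof -
  have "G ` A \<subseteq> polynomial_algebra X (G ` A)"
  proof
    fix b assume b: "b \<in> G ` A"
    have "(\<lambda>x\<in>X. b x) \<in> polynomial_algebra X (G ` A)"
      using polynomial_algebraI[OF coordinate_polynomial_map[of 0 1], of "\<lambda>_. b" "G ` A" X] b
      by (auto simp: inj_on_def)
    then show "b \<in> polynomial_algebra X (G ` A)"
      using b assms(2) by (metis extensional_restrict subsetD)
  qed
  moreover have "G ` A \<approx> A"
    using assms(1) by (simp add: inj_on_image_eqpoll_self)
  moreover have "mpoly_of_functions X P f \<noteq> (\<lambda>x\<in>X. 0)"
    if P: "P \<in> mpolys_no_const N" "P \<noteq> 0" and f: "f ` {..<N} \<subseteq> G ` A" "inj_on f {..<N}" for N P f
  proof -
    have "\<exists>a\<in>A. f i = G a" if "i < N" for i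
      using f(1) that by blast
    then obtain t where t: "\<And>i. i < N \<Longrightarrow> t i \<in> A" "\<And>i. i < N \<Longrightarrow> f i = G (t i)"
      by metis
    have "inj_on t {..<N}"
      using f(2) t(2) unfolding inj_on_def lessThan_iff by fastforce
    then obtain x where x: "x \<in> X" "mpoly_eval P (\<lambda>i. G (t i) x) \<noteq> 0"
      using indep[OF P, of t] t(1) by blast
    have "mpoly_of_functions X P f x = mpoly_eval P (\<lambda>i. G (t i) x)"
      using x(1) t(2) by (simp add: mpoly_of_functions_def mpoly_eval_cong[OF P(1), of "\<lambda>i. f i x" "\<lambda>i. G (t i) x"])
    with x have "mpoly_of_functions X P f x \<noteq> (\<lambda>x\<in>X. 0) x"
      by simp
    then show ?thesis
      by (rule contrapos_nn) (simp only:)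
  qed
  ultimately show ?thesis
    unfolding free_function_algebra_def
    using function_subalgebra_polynomial_algebra[of X "G ` A"]
    by (intro conjI exI[of _ "G ` A"]) (auto simp: polynomial_algebra_def)
qed

section \<open>Functions that are flat of different orders at zero\<close>

text \<open>The largest exponent that occurs with a nonzero coefficient decides: after division by its
  power of \<open>s\<close> the sum tends to that coefficient.\<close>

lemma sum_powr_dominant:
  fixes d p :: "'i \<Rightarrow> real"
  assumes "finite I" "inj_on p I" "\<And>i. i \<in> I \<Longrightarrow> p i > 0" and ne: "\<exists>i\<in>I. d i \<noteq> 0"
  shows "filterlim (\<lambda>s. \<Sum>i\<in>I. d i * s powr (- p i)) at_top (at_right 0) \<or>
         filterlim (\<lambda>s. \<Sum>i\<in>I. d i * s powr (- p i)) at_bot (at_right 0)"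
proof -
  let ?J = "{i\<in>I. d i \<noteq> 0}"
  have J: "finite ?J" "?J \<noteq> {}" using assms by auto
  have "Max (p ` ?J) \<in> p ` ?J" using J by (intro Max_in) auto
  then obtain j where "j \<in> ?J" "p j = Max (p ` ?J)" by auto
  then have "\<exists>j\<in>?J. \<forall>i\<in>?J. p i \<le> p j"
    using J(1) by (intro bexI[of _ j]) auto
  then obtain j where j: "j \<in> I" "d j \<noteq> 0" and max: "\<And>i. i \<in> I \<Longrightarrow> d i \<noteq> 0 \<Longrightarrow> p i \<le> p j"
    by auto
  have lim: "((\<lambda>s. d i * s powr (p j - p i)) \<longlongrightarrow> (if i = j then d j else 0)) (at_right 0)" if i: "i \<in> I" for i
  proof (cases "d i = 0 \<or> i = j")
    case True
    have "((\<lambda>s. d j * s powr 0) \<longlongrightarrow> d j) (at_right 0)"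
      by real_asymp
    with True j show ?thesis by auto
  next
    case False
    then have "p i < p j"
      using max[OF i] i j inj_onD[OF assms(2), of i j] by fastforce
    then have "((\<lambda>s. s powr (p j - p i)) \<longlongrightarrow> 0) (at_right 0)"
      by real_asymp
    from tendsto_mult_left[OF this, of "d i"] show ?thesis using False by simp
  qed
  have "((\<lambda>s. \<Sum>i\<in>I. d i * s powr (p j - p i)) \<longlongrightarrow> (\<Sum>i\<in>I. if i = j then d j else 0)) (at_right 0)"
    by (intro tendsto_sum lim)
  then have lim: "((\<lambda>s. \<Sum>i\<in>I. d i * s powr (p j - p i)) \<longlongrightarrow> d j) (at_right 0)"
    using j assms(1) by simp
  have top: "filterlim (\<lambda>s::real. s powr (- p j)) at_top (at_right 0)"
    using assms(3)[OF j(1)] by real_asymp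
  have eq: "\<forall>\<^sub>F s in at_right 0. (\<Sum>i\<in>I. d i * s powr (p j - p i)) * s powr (- p j) =
        (\<Sum>i\<in>I. d i * s powr (- p i))"
    using eventually_at_right_less[of 0]
    by eventually_elim (simp add: sum_distrib_right mult.assoc powr_add[symmetric])
  show ?thesis
  proof (cases "d j > 0")
    case True
    from filterlim_tendsto_pos_mult_at_top[OF lim True top] show ?thesis
      by (simp add: filterlim_cong[OF refl refl eq])
  next
    case False
    then have "d j < 0" using j by simp
    from filterlim_tendsto_neg_mult_at_bot[OF lim this top] show ?thesis
      by (simp add: filterlim_cong[OF refl refl eq])
  qed
qed

text \<open>The exponent is \<open>exp \<tau>\<close> so that the whole real line indexes positive exponents.\<close>

definition flat_exp :: "real \<Rightarrow> real \<Rightarrow> real" where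
  "flat_exp \<tau> s = (if s > 0 then exp (- (s powr (- exp \<tau>))) else 0)"

lemma flat_exp_bounds: "0 \<le> flat_exp \<tau> s" "flat_exp \<tau> s \<le> 1"
  by (auto simp: flat_exp_def)

lemma continuous_on_flat_exp: "continuous_on {0..} (flat_exp \<tau>)"
proof -
  have "continuous (at s within {0..}) (flat_exp \<tau>)" if "s \<ge> 0" for s
  proof (cases "s = 0")
    case False
    then have s: "s > 0" using that by simp
    have "\<forall>\<^sub>F y in nhds s. flat_exp \<tau> y = exp (- (y powr (- exp \<tau>)))"
      using eventually_nhds_in_open[of "{0<..}" s] s
      by (auto simp: flat_exp_def elim: eventually_mono)
    moreover have "isCont (\<lambda>y. exp (- (y powr (- exp \<tau>)))) s"
      using s by (intro continuous_intros) auto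
    ultimately have "isCont (flat_exp \<tau>) s"
      by (simp add: isCont_cong)
    then show ?thesis by (rule continuous_at_imp_continuous_at_within)
  next
    case True
    have "((\<lambda>s. exp (- (s powr (- exp \<tau>)))) \<longlongrightarrow> 0) (at_right 0)"
    proof -
      have "exp \<tau> > 0" by simp
      then have "filterlim (\<lambda>s::real. s powr (- exp \<tau>)) at_top (at_right 0)"
        by real_asymp
      then show ?thesis
        by (intro filterlim_compose[OF exp_at_bot] filterlim_compose[OF filterlim_uminus_at_bot_at_top])
    qed
    moreover have "\<forall>\<^sub>F s in at_right 0. flat_exp \<tau> s = exp (- (s powr (- exp \<tau>)))"
      using eventually_at_right_less[of 0] by eventually_elim (simp add: flat_exp_def)
    ultimately have "(flat_exp \<tau> \<longlongrightarrow> 0) (at_right 0)"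
      by (simp add: filterlim_cong)
    then show ?thesis
      using True by (simp add: continuous_within flat_exp_def at_within_Ici_at_right)
  qed
  then show ?thesis by (simp add: continuous_on_eq_continuous_within)
qed

text \<open>A monomial in these functions is \<open>exp (- L s)\<close> where \<open>L\<close> is a sum of powers with negative exponents.
  For two distinct monomials the difference of the \<open>L\<close> tends to plus or minus infinity by
  \<open>sum_powr_dominant\<close>, so the monomials of \<open>P\<close> are linearly ordered by size near \<open>0\<close>; divided by the largest one, the value of \<open>P\<close> tends to a
  nonzero coefficient.\<close>

lemma flat_exp_independent:
  assumes P: "P \<in> mpolys_no_const N" "P \<noteq> 0" and \<tau>: "inj_on \<tau> {..<N}"
  shows "\<forall>\<^sub>F s in at_right 0. mpoly_eval P (\<lambda>i. flat_exp (\<tau> i) s) \<noteq> 0"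
proof -
  define L where "L m s = (\<Sum>i<N. real (Poly_Mapping.lookup m i) * s powr (- exp (\<tau> i)))" for m s
  define R where "R m m' \<longleftrightarrow> filterlim (\<lambda>s. L m' s - L m s) at_top (at_right 0)" for m m'
  let ?K = "Poly_Mapping.keys P"
  have diff: "L m' s - L m s = (\<Sum>i<N. (real (Poly_Mapping.lookup m' i) - real (Poly_Mapping.lookup m i)) * s powr (- exp (\<tau> i)))"
    for m m' s by (simp add: L_def sum_subtractf left_diff_distrib)
  have total: "R m m' \<or> R m' m" if mm: "m \<in> ?K" "m' \<in> ?K" "m \<noteq> m'" for m m'
  proof -
    obtain i where i: "Poly_Mapping.lookup m i \<noteq> Poly_Mapping.lookup m' i"
      using mm(3) by (auto simp: poly_mapping_eq_iff fun_eq_iff)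
    then have "i \<in> Poly_Mapping.keys m \<union> Poly_Mapping.keys m'"
      by (auto simp: in_keys_iff)
    then have "i < N"
      using no_const_keys(2)[OF P(1) mm(1)] no_const_keys(2)[OF P(1) mm(2)] by blast
    then have "filterlim (\<lambda>s. L m' s - L m s) at_top (at_right 0) \<or>
         filterlim (\<lambda>s. L m' s - L m s) at_bot (at_right 0)"
      unfolding diff using \<tau> i by (intro sum_powr_dominant) (auto simp: inj_on_def intro!: bexI[of _ i])
    then show ?thesis
      unfolding R_def by (auto simp: filterlim_uminus_at_bot)
  qed
  have trans: "R m m''" if "R m m'" "R m' m''" for m m' m''
    using filterlim_at_top_add_at_top[OF that[unfolded R_def]] by (simp add: R_def)
  have irrefl: "\<not> R m m" for m
    unfolding R_def by (auto simp: filterlim_at_top_dense intro: exI[of _ 0])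
  \<comment> \<open>\<open>R m m'\<close> says that the monomial of \<open>m\<close> is the larger one near \<open>0\<close>.\<close>
  have "\<exists>m\<in>?K. \<forall>m'\<in>?K. m' \<noteq> m \<longrightarrow> \<not> R m' m"
  proof (rule Finite_Set.bex_min_element)
    show "?K \<noteq> {}"
      using P(2) by simp
    show "asymp_on ?K R"
      by (rule asymp_onI) (use trans irrefl in blast)
    show "transp_on ?K R"
      by (rule transp_onI) (rule trans)
  qed simp
  then obtain m where m: "m \<in> ?K" and min: "\<And>m'. m' \<in> ?K \<Longrightarrow> m' \<noteq> m \<Longrightarrow> R m m'"
    using total by metis
  have lim: "((\<lambda>s. Poly_Mapping.lookup P m' * exp (- (L m' s - L m s))) \<longlongrightarrow>
       (if m' = m then Poly_Mapping.lookup P m else 0)) (at_right 0)" if "m' \<in> ?K" for m'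
  proof (cases "m' = m")
    case False
    then have "((\<lambda>s. exp (- (L m' s - L m s))) \<longlongrightarrow> 0) (at_right 0)"
      using min[OF that] unfolding R_def
      by (intro filterlim_compose[OF exp_at_bot] filterlim_compose[OF filterlim_uminus_at_bot_at_top])
    from tendsto_mult_left[OF this, of "Poly_Mapping.lookup P m'"] show ?thesis using False by simp
  qed simp
  have "((\<lambda>s. \<Sum>m'\<in>?K. Poly_Mapping.lookup P m' * exp (- (L m' s - L m s))) \<longlongrightarrow>
      (\<Sum>m'\<in>?K. if m' = m then Poly_Mapping.lookup P m else 0)) (at_right 0)"
    by (intro tendsto_sum lim)
  then have "((\<lambda>s. \<Sum>m'\<in>?K. Poly_Mapping.lookup P m' * exp (- (L m' s - L m s))) \<longlongrightarrow>
      Poly_Mapping.lookup P m) (at_right 0)"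
    using m by simp
  then have "\<forall>\<^sub>F s in at_right 0. (\<Sum>m'\<in>?K. Poly_Mapping.lookup P m' * exp (- (L m' s - L m s))) \<noteq> 0"
    using m by (intro tendsto_imp_eventually_ne) (auto simp: in_keys_iff)
  with eventually_at_right_less[of 0] show ?thesis
  proof eventually_elim
    case (elim s)
    have mono: "monomial_value m' (\<lambda>i. flat_exp (\<tau> i) s) = exp (- L m' s)" if "m' \<in> ?K" for m'
      using elim(1) no_const_keys(2)[OF P(1) that]
      by (simp add: monomial_value_superset[of "{..<N}"] flat_exp_def L_def sum_negf[symmetric] exp_sum
           exp_of_nat_mult[symmetric])
    have "exp (- (L m' s - L m s)) = exp (- L m' s) * exp (L m s)" for m'
      by (simp flip: exp_add)
    then have "mpoly_eval P (\<lambda>i. flat_exp (\<tau> i) s) * exp (L m s) =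
        (\<Sum>m'\<in>?K. Poly_Mapping.lookup P m' * exp (- (L m' s - L m s)))"
      unfolding mpoly_eval_def monomial_value_def[symmetric]
      by (simp only: sum_distrib_right mult.assoc) (intro sum.cong refl, simp add: mono)
    then show ?case using elim(2) by auto
  qed
qed

lemma flat_exp_separates:
  assumes "\<sigma> \<noteq> \<tau>" "0 < s" "s < 1"
  shows "flat_exp \<sigma> s \<noteq> flat_exp \<tau> s"
  using assms by (simp add: flat_exp_def powr_inj)

section \<open>Riemann integrability and oscillation\<close>

text \<open>Distinct members overlap at most in end points, so the total length is a measure and can be compared
  with the measure of other sets.\<close>

lemma tagged_partial_division_measure_Union:
  fixes q :: "(real \<times> real set) set"
  assumes q: "q tagged_partial_division_of i"
  shows "(\<Union>(x, K)\<in>q. K) \<in> lmeasurable"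
    and "(\<Sum>(x, K)\<in>q. measure lborel K) = measure lebesgue (\<Union>(x, K)\<in>q. K)"
proof -
  note D = tagged_partial_division_ofD[OF q]
  have meas: "snd z \<in> lmeasurable" if "z \<in> q" for z
    using D(4)[of "fst z" "snd z"] that by auto
  have frontier: "negligible (K - interior K)" "closed K" if "(x, K) \<in> q" for x K
    using D(4)[OF that] negligible_frontier_interval[where ?'a = real] by (auto simp del: box_real)
  have "pairwise (\<lambda>z w. negligible (snd z \<inter> snd w)) q"
  proof (rule pairwiseI)
    fix z w assume *: "z \<in> q" "w \<in> q" "z \<noteq> w"
    then have "interior (snd z) \<inter> interior (snd w) = {}"
      using D(5)[of "fst z" "snd z" "fst w" "snd w"] by simp
    then have "snd z \<inter> snd w \<subseteq> (snd z - interior (snd z)) \<union> (snd w - interior (snd w))"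
      by blast
    moreover have "negligible ((snd z - interior (snd z)) \<union> (snd w - interior (snd w)))"
      using frontier(1)[of "fst z" "snd z"] frontier(1)[of "fst w" "snd w"] * by (auto intro: negligible_Un)
    ultimately show "negligible (snd z \<inter> snd w)"
      using negligible_subset by blast
  qed
  then have "measure lebesgue (\<Union>z\<in>q. snd z) = (\<Sum>z\<in>q. measure lebesgue (snd z))"
    using D(1) meas by (intro measure_negligible_finite_Union_image) auto
  moreover have "measure lebesgue (snd z) = measure lborel (snd z)" if "z \<in> q" for z
    using D(4)[of "fst z" "snd z"] that by auto
  ultimately show "(\<Sum>(x, K)\<in>q. measure lborel K) = measure lebesgue (\<Union>(x, K)\<in>q. K)"
    by (simp add: case_prod_beta)
  show "(\<Union>(x, K)\<in>q. K) \<in> lmeasurable"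
    using D(1) meas by (auto simp: case_prod_beta intro: fmeasurable.finite_UN)
qed

text \<open>Only tags in \<open>Z\<close> contribute to a Riemann sum.  On a compact interval \<open>Z\<close> is compact, so it has
  positive distance from the complement of an open neighbourhood of small measure; for small mesh the partition intervals
  with such tags lie in that neighbourhood, and their lengths add up to at most its measure.\<close>

lemma riemann_integrable_zero_off_closed_null:
  assumes Z: "closed Z" "negligible Z" and bound: "\<And>x. \<bar>f x\<bar> \<le> M" and zero: "\<And>x. x \<notin> Z \<Longrightarrow> f x = 0"
  shows "riemann_integrable f a b"
  unfolding riemann_integrable_def
proof (rule exI[of _ 0], intro allI impI)
  fix \<epsilon> :: real assume \<epsilon>: "\<epsilon> > 0"
  have nonzero: "x \<in> Z" if "f x \<noteq> 0" for x using that zero by blast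
  have M: "M \<ge> 0" using bound[of 0] by linarith
  let ?Z = "Z \<inter> {a..b}"
  have negl: "negligible ?Z"
    using Z(2) negligible_subset by blast
  \<comment> \<open>\<open>M + 1\<close> instead of \<open>M\<close>, since \<open>M\<close> may be \<open>0\<close>.\<close>
  have "0 < \<epsilon> / (M + 1)" using \<epsilon> M by simp
  then obtain T where T: "open T" "?Z \<subseteq> T" "T - ?Z \<in> lmeasurable"
      "emeasure lebesgue (T - ?Z) < ennreal (\<epsilon> / (M + 1))"
    using sets_lebesgue_outer_open[OF negligible_imp_sets[OF negl]] by metis
  have T_eq: "T = (T - ?Z) \<union> ?Z" using T(2) by blast
  have Tm: "T \<in> lmeasurable"
    using fmeasurable.Un[OF T(3) negligible_imp_measurable[OF negl]] T_eq by simp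
  have "measure lebesgue T \<le> measure lebesgue (T - ?Z) + measure lebesgue ?Z"
    using measure_Un_le[OF fmeasurableD[OF T(3)] negligible_imp_sets[OF negl]] T_eq by simp
  also have "\<dots> = measure lebesgue (T - ?Z)"
    using negl by (simp add: negligible_imp_measure0)
  also have "\<dots> < \<epsilon> / (M + 1)"
    using T(3,4) \<open>0 < \<epsilon> / (M + 1)\<close> by (simp add: emeasure_eq_measure2 ennreal_less_iff)
  finally have Tsmall: "measure lebesgue T < \<epsilon> / (M + 1)" .
  have "compact ?Z" using Z(1) by (simp add: closed_Int_compact)
  moreover have "closed (- T)" using T(1) by (simp add: closed_Compl)
  moreover have "?Z \<inter> - T = {}" using T(2) by blast
  ultimately obtain \<delta> where \<delta>: "\<delta> > 0" "\<And>x y. x \<in> ?Z \<Longrightarrow> y \<notin> T \<Longrightarrow> \<delta> \<le> dist x y"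
    using separate_compact_closed[of ?Z "- T"] by auto
  show "\<exists>\<delta>>0. \<forall>p. p tagged_division_of {a..b} \<and> (\<forall>(x, K)\<in>p. measure lborel K < \<delta>) \<longrightarrow>
      \<bar>(\<Sum>(x, K)\<in>p. measure lborel K * f x) - 0\<bar> < \<epsilon>"
  proof (intro exI[of _ \<delta>] conjI allI impI)
    show "\<delta> > 0" by (rule \<delta>(1))
    fix p assume p: "p tagged_division_of {a..b} \<and> (\<forall>(x, K)\<in>p. measure lborel K < \<delta>)"
    then have tag: "p tagged_division_of {a..b}" by (rule conjunct1)
    have mesh: "measure lborel K < \<delta>" if "(x, K) \<in> p" for x K
      using bspec[OF conjunct2[OF p] that] by simp
    note D = tagged_division_ofD[OF tag]
    define q where "q = {z\<in>p. fst z \<in> Z}"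
    have q: "q tagged_partial_division_of {a..b}"
      by (rule tagged_partial_division_subset[of p]) (use tag in \<open>auto simp: q_def tagged_division_of_def\<close>)
    have "(\<Union>(x, K)\<in>q. K) \<subseteq> T"
    proof clarify
      fix y x K assume xK: "(x, K) \<in> q" and y: "y \<in> K"
      then have p: "(x, K) \<in> p" by (simp add: q_def)
      note K = D(2)[OF p] D(3)[OF p] mesh[OF p]
      obtain u v where uv: "K = {u..v}"
        using D(4)[OF p] by auto
      have "dist x y < \<delta>"
        using K y uv by (auto simp: dist_real_def)
      moreover have "x \<in> ?Z" using xK K by (auto simp: q_def)
      ultimately show "y \<in> T" using \<delta>(2)[of x y] by force
    qed
    then have "measure lebesgue (\<Union>(x, K)\<in>q. K) \<le> measure lebesgue T"
      using tagged_partial_division_measure_Union(1)[OF q] Tm by (intro measure_mono_fmeasurable) auto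
    then have small: "(\<Sum>(x, K)\<in>q. measure lborel K) < \<epsilon> / (M + 1)"
      using Tsmall by (simp add: tagged_partial_division_measure_Union(2)[OF q])
    have "(\<Sum>(x, K)\<in>p. measure lborel K * f x) = (\<Sum>(x, K)\<in>q. measure lborel K * f x)"
      using D(1) zero by (intro sum.mono_neutral_right) (auto simp: q_def dest: nonzero)
    also have "\<bar>\<dots>\<bar> \<le> (\<Sum>(x, K)\<in>q. measure lborel K * (M + 1))"
      by (rule order_trans[OF sum_abs sum_mono])
         (auto simp: abs_mult intro!: mult_left_mono order_trans[OF bound])
    also have "\<dots> = (\<Sum>(x, K)\<in>q. measure lborel K) * (M + 1)"
      by (simp add: sum_distrib_right case_prod_beta)
    also have "\<dots> < \<epsilon>"
      using small M by (simp add: field_simps)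
    finally show "\<bar>(\<Sum>(x, K)\<in>p. measure lborel K * f x) - 0\<bar> < \<epsilon>" by simp
  qed
qed

text \<open>A partition interval without interior may occur with several tags, and moving these could make two
  members coincide.  Such tags therefore stay in place.\<close>

lemma tagged_division_retag:
  assumes p: "p tagged_division_of i"
    and t: "\<And>x K. (x, K) \<in> p \<Longrightarrow> t x K \<in> K"
    and degenerate: "\<And>x K. (x, K) \<in> p \<Longrightarrow> interior K = {} \<Longrightarrow> t x K = x"
  shows "(\<lambda>(x, K). (t x K, K)) ` p tagged_division_of i" and "inj_on (\<lambda>(x, K). (t x K, K)) p"
proof -
  note D = tagged_division_ofD[OF p]
  show "inj_on (\<lambda>(x, K). (t x K, K)) p"
  proof (rule inj_onI)
    fix z w assume *: "z \<in> p" "w \<in> p" "(\<lambda>(x, K). (t x K, K)) z = (\<lambda>(x, K). (t x K, K)) w"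
    obtain x y K where zw: "z = (x, K)" "w = (y, K)" "t x K = t y K"
      using *(3) by (cases z, cases w) auto
    show "z = w"
    proof (rule ccontr)
      assume "z \<noteq> w"
      then have "interior K = {}" using D(5)[of x K y K] * zw by simp
      then show False using degenerate[of x K] degenerate[of y K] * zw \<open>z \<noteq> w\<close> by simp
    qed
  qed
  show "(\<lambda>(x, K). (t x K, K)) ` p tagged_division_of i"
  proof (rule tagged_division_ofI)
    show "\<Union>{K. \<exists>x. (x, K) \<in> (\<lambda>(x, K). (t x K, K)) ` p} = i"
      unfolding D(6)[symmetric] by (rule arg_cong[where f = Union]) force
  next
    fix x1 K1 x2 K2
    assume "(x1, K1) \<in> (\<lambda>(x, K). (t x K, K)) ` p" "(x2, K2) \<in> (\<lambda>(x, K). (t x K, K)) ` p" "(x1, K1) \<noteq> (x2, K2)"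
    then obtain y1 y2 where "(y1, K1) \<in> p" "(y2, K2) \<in> p" "(y1, K1) \<noteq> (y2, K2)" by auto
    then show "interior K1 \<inter> interior K2 = {}" by (rule D(5))
  qed (use D t in \<open>auto simp: subset_iff\<close>)
qed

text \<open>Two taggings of one fine partition are compared.  On every interval whose interior meets \<open>E\<close> one of them selects a
  point with value \<open>c\<close> and the other a point with value \<open>0\<close>; elsewhere they agree.  Those intervals cover
  \<open>E\<close> up to finitely many end points.\<close>

lemma oscillating_not_riemann_integrable:
  fixes f :: "real \<Rightarrow> real"
  assumes E: "E \<in> lmeasurable" "measure lebesgue E > 0" "E \<subseteq> {a..b}" and c: "c \<noteq> 0"
    and osc: "\<And>u v. {u..v} \<subseteq> {a..b} \<Longrightarrow> {u<..<v} \<inter> E \<noteq> {} \<Longrightarrow>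
        (\<exists>x\<in>{u..v}. f x = c) \<and> (\<exists>x\<in>{u..v}. f x = 0)"
  shows "\<not> riemann_integrable f a b"
proof
  assume "riemann_integrable f a b"
  then obtain I where I: "\<And>\<epsilon>. \<epsilon> > 0 \<Longrightarrow> \<exists>\<delta>>0. \<forall>p. p tagged_division_of {a..b} \<and> (\<forall>(x, K)\<in>p. measure lborel K < \<delta>) \<longrightarrow>
      \<bar>(\<Sum>(x, K)\<in>p. measure lborel K * f x) - I\<bar> < \<epsilon>"
    unfolding riemann_integrable_def by blast
  define \<epsilon> where "\<epsilon> = \<bar>c\<bar> * measure lebesgue E / 2"
  have "\<epsilon> > 0" using E(2) c by (simp add: \<epsilon>_def)
  then obtain \<delta> where \<delta>: "\<delta> > 0" and close: "\<And>p. p tagged_division_of {a..b} \<Longrightarrow> \<forall>(x, K)\<in>p. measure lborel K < \<delta> \<Longrightarrow>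
      \<bar>(\<Sum>(x, K)\<in>p. measure lborel K * f x) - I\<bar> < \<epsilon>"
    using I by meson
  \<comment> \<open>An interval inside a ball of radius \<open>\<delta> / 2\<close> is shorter than \<open>\<delta>\<close>.\<close>
  have "gauge (\<lambda>x::real. ball x (\<delta> / 2))"
    using \<delta> by (simp add: gauge_def)
  then obtain p where p: "p tagged_division_of {a..b}" and fine: "(\<lambda>x. ball x (\<delta> / 2)) fine p"
    using fine_division_exists_real by blast
  note D = tagged_division_ofD[OF p]
  have mesh: "measure lborel K < \<delta>" if xK: "(x, K) \<in> p" for x K
  proof -
    obtain u v where uv: "K = {u..v}" using D(4)[OF xK] by auto
    have "u \<le> v" using D(2)[OF xK] uv by auto
    moreover have "{u..v} \<subseteq> ball x (\<delta> / 2)" using fine xK uv by (auto simp: fine_def)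
    ultimately have "dist x u < \<delta> / 2" "dist x v < \<delta> / 2" by (auto simp: subset_iff)
    then have "v - u < \<delta>" unfolding dist_real_def by linarith
    then show ?thesis using uv \<open>u \<le> v\<close> by simp
  qed
  define good where "good K \<longleftrightarrow> interior K \<inter> E \<noteq> {}" for K
  have tags: "\<exists>x\<in>K. f x = c" "\<exists>x\<in>K. f x = 0" if yK: "(y, K) \<in> p" "good K" for y K
  proof -
    obtain u v where uv: "K = {u..v}" using D(4)[OF yK(1)] by auto
    then have "{u<..<v} \<inter> E \<noteq> {}" using yK(2) by (simp add: good_def)
    then show "\<exists>x\<in>K. f x = c" "\<exists>x\<in>K. f x = 0"
      using osc[of u v] D(3)[OF yK(1)] uv by auto
  qed
  define t where "t d x K = (if good K then SOME y. y \<in> K \<and> f y = d else x)" for d x K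
  have t_not_good: "t d x K = x" if "\<not> good K" for d x K using that by (simp add: t_def)
  have sel: "t d x K \<in> K \<and> f (t d x K) = d" if "(x, K) \<in> p" "good K" "d = c \<or> d = 0" for d x K
  proof -
    have "\<exists>y. y \<in> K \<and> f y = d" using tags[OF that(1,2)] that(3) by auto
    from someI_ex[OF this] show ?thesis using that(2) by (simp add: t_def)
  qed
  have sums: "\<bar>(\<Sum>(x, K)\<in>p. measure lborel K * f (t d x K)) - I\<bar> < \<epsilon>" if d: "d = c \<or> d = 0" for d
  proof -
    let ?g = "\<lambda>(x, K). (t d x K, K)"
    have in_K: "t d x K \<in> K" if "(x, K) \<in> p" for x K
      using sel[OF that _ d] D(2)[OF that] by (cases "good K") (auto simp: t_def split: if_splits)
    have deg: "t d x K = x" if "interior K = {}" for x K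
      using that by (simp add: t_def good_def)
    have retag: "?g ` p tagged_division_of {a..b}" "inj_on ?g p"
      by (rule tagged_division_retag[OF p in_K deg]; assumption)+
    have "\<forall>(x, K)\<in>?g ` p. measure lborel K < \<delta>"
      by (auto intro: mesh)
    have "(\<Sum>(x, K)\<in>?g ` p. measure lborel K * f x) = (\<Sum>(x, K)\<in>p. measure lborel K * f (t d x K))"
      by (subst sum.reindex[OF retag(2)]) (rule sum.cong[OF refl], clarsimp)
    with close[OF retag(1) \<open>\<forall>(x, K)\<in>?g ` p. measure lborel K < \<delta>\<close>] show ?thesis
      by simp
  qed
  let ?G = "{z\<in>p. good (snd z)}"
  have G: "?G tagged_partial_division_of {a..b}"
    by (rule tagged_partial_division_subset[of p]) (use p in \<open>auto simp: tagged_division_of_def\<close>)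
  have "(\<Sum>(x, K)\<in>p. measure lborel K * f (t c x K)) - (\<Sum>(x, K)\<in>p. measure lborel K * f (t 0 x K))
      = (\<Sum>(x, K)\<in>p. measure lborel K * (f (t c x K) - f (t 0 x K)))"
    by (simp add: sum_subtractf[symmetric] right_diff_distrib case_prod_beta)
  also have "\<dots> = (\<Sum>(x, K)\<in>?G. measure lborel K * (f (t c x K) - f (t 0 x K)))"
    using D(1) by (intro sum.mono_neutral_right) (auto, metis t_not_good)
  also have "\<dots> = (\<Sum>(x, K)\<in>?G. measure lborel K * c)"
    by (intro sum.cong refl) (use sel in auto)
  also have "\<dots> = measure lebesgue (\<Union>(x, K)\<in>?G. K) * c"
    unfolding tagged_partial_division_measure_Union(2)[OF G, symmetric]
    by (simp add: sum_distrib_right case_prod_beta)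
  finally have diff: "(\<Sum>(x, K)\<in>p. measure lborel K * f (t c x K)) - (\<Sum>(x, K)\<in>p. measure lborel K * f (t 0 x K))
      = measure lebesgue (\<Union>(x, K)\<in>?G. K) * c" .
  have "\<bar>measure lebesgue (\<Union>(x, K)\<in>?G. K) * c\<bar> < 2 * \<epsilon>"
    using sums[of c] sums[of 0] unfolding diff[symmetric] by (simp add: abs_le_iff abs_less_iff)
  then have "measure lebesgue (\<Union>(x, K)\<in>?G. K) * \<bar>c\<bar> < measure lebesgue E * \<bar>c\<bar>"
    by (simp add: \<epsilon>_def abs_mult mult.commute)
  then have less: "measure lebesgue (\<Union>(x, K)\<in>?G. K) < measure lebesgue E"
    using c by simp
  let ?N = "\<Union>z\<in>p. snd z - interior (snd z)"
  have "negligible (snd z - interior (snd z))" if "z \<in> p" for z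
    using D(4)[of "fst z" "snd z"] that negligible_frontier_interval[where ?'a = real]
    by (auto simp del: box_real)
  then have N: "negligible ?N"
    using D(1) by (intro negligible_Union) auto
  have "E \<subseteq> (\<Union>(x, K)\<in>?G. K) \<union> ?N"
  proof
    fix y assume y: "y \<in> E"
    then have "y \<in> \<Union>{K. \<exists>x. (x, K) \<in> p}" using E(3) D(6) by blast
    then obtain x K where xK: "(x, K) \<in> p" "y \<in> K" by blast
    show "y \<in> (\<Union>(x, K)\<in>?G. K) \<union> ?N"
      using xK y by (cases "y \<in> interior K") (auto simp: good_def intro!: bexI[of _ "(x, K)"])
  qed
  then have "measure lebesgue E \<le> measure lebesgue ((\<Union>(x, K)\<in>?G. K) \<union> ?N)"
    using E(1) fmeasurable.Un[OF tagged_partial_division_measure_Union(1)[OF G] negligible_imp_measurable[OF N]]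
    by (intro measure_mono_fmeasurable fmeasurableD)
  also have "\<dots> \<le> measure lebesgue (\<Union>(x, K)\<in>?G. K) + measure lebesgue ?N"
    by (rule measure_Un_le[OF fmeasurableD[OF tagged_partial_division_measure_Union(1)[OF G]] negligible_imp_sets[OF N]])
  also have "\<dots> = measure lebesgue (\<Union>(x, K)\<in>?G. K)"
    using N by (simp add: negligible_imp_measure0)
  finally show False using less by simp
qed

section \<open>A null Cantor set\<close>

text \<open>The standard parametrization of the Cantor set: the elements of \<open>S\<close> are the positions of the ternary digit \<open>2\<close>,
  all other digits being \<open>0\<close>.\<close>

definition ternary_sum :: "nat set \<Rightarrow> real" where
  "ternary_sum S = (suminf (\<lambda>i. (if i \<in> S then 2 else 0) * (1 / 3) ^ Suc i))"

abbreviation shift_down :: "nat set \<Rightarrow> nat set" where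
  "shift_down S \<equiv> {i. Suc i \<in> S}"

lemma geometric_ternary_sums: "(\<lambda>i. 2 * (1 / 3 :: real) ^ Suc i) sums 1"
  using sums_mult[OF geometric_sums[of "1 / 3 :: real"], of "2 / 3"] by simp

lemma summable_ternary: "summable (\<lambda>i. (if i \<in> S then 2 else 0) * (1 / 3 :: real) ^ Suc i)"
  by (rule summable_comparison_test[OF _ sums_summable[OF geometric_ternary_sums]]) auto

lemma ternary_sum_nonneg: "0 \<le> ternary_sum S"
  unfolding ternary_sum_def by (rule suminf_nonneg[OF summable_ternary]) auto

lemma ternary_sum_le_1: "ternary_sum S \<le> 1"
proof -
  have "ternary_sum S \<le> suminf (\<lambda>i. 2 * (1 / 3 :: real) ^ Suc i)"
    unfolding ternary_sum_def
    by (rule suminf_le[OF _ summable_ternary sums_summable[OF geometric_ternary_sums]]) auto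
  then show ?thesis using sums_unique[OF geometric_ternary_sums] by linarith
qed

text \<open>Self-similarity of the Cantor set; it yields injectivity of the parametrization, the smallness
  of points with many leading zeros, and nullity.\<close>

lemma ternary_sum_unfold:
  "ternary_sum S = (if 0 \<in> S then 2 / 3 else 0) + ternary_sum (shift_down S) / 3"
proof -
  define F where "F T i = (if i \<in> T then 2 else 0) * (1 / 3 :: real) ^ Suc i" for T :: "nat set" and i
  have F: "summable (F T)" "ternary_sum T = suminf (F T)" for T
    using summable_ternary[of T] by (simp_all add: F_def[abs_def] ternary_sum_def)
  have "(\<lambda>i. F S (Suc i)) = (\<lambda>i. F (shift_down S) i / 3)"
    by (simp add: F_def fun_eq_iff)
  then have "suminf (F (shift_down S)) / 3 = suminf (F S) - F S 0"
    using suminf_split_head[OF F(1)[of S]] suminf_divide[OF F(1)[of "shift_down S"], of 3] by simp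
  moreover have "F S 0 = (if 0 \<in> S then 2 / 3 else 0)" by (simp add: F_def)
  ultimately show ?thesis unfolding F(2) by linarith
qed

text \<open>The images of \<open>{0..1}\<close> under the two similarities are \<open>{0..1/3}\<close> and \<open>{2/3..1}\<close>, which are disjoint.\<close>

lemma ternary_sum_eqD:
  assumes "ternary_sum S = ternary_sum T"
  shows "0 \<in> S \<longleftrightarrow> 0 \<in> T" "ternary_sum (shift_down S) = ternary_sum (shift_down T)"
proof -
  have "(if 0 \<in> S then 2 / 3 else 0) + ternary_sum (shift_down S) / 3 =
        (if 0 \<in> T then 2 / 3 else 0) + ternary_sum (shift_down T) / 3"
    using assms ternary_sum_unfold[of S] ternary_sum_unfold[of T] by linarith
  moreover note ternary_sum_nonneg[of "shift_down S"] ternary_sum_nonneg[of "shift_down T"]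
    ternary_sum_le_1[of "shift_down S"] ternary_sum_le_1[of "shift_down T"]
  ultimately have "(0 \<in> S \<longleftrightarrow> 0 \<in> T) \<and> ternary_sum (shift_down S) = ternary_sum (shift_down T)"
    by (cases "0 \<in> S"; cases "0 \<in> T"; simp only: if_True if_False simp_thms; linarith)
  then show "0 \<in> S \<longleftrightarrow> 0 \<in> T" "ternary_sum (shift_down S) = ternary_sum (shift_down T)"
    by blast+
qed

lemma inj_ternary_sum: "inj ternary_sum"
proof (rule injI)
  have "n \<in> S \<longleftrightarrow> n \<in> T" if "ternary_sum S = ternary_sum T" for n S T
    using that
  proof (induction n arbitrary: S T)
    case 0
    then show ?case by (rule ternary_sum_eqD(1))
  next
    case (Suc n)
    from Suc.IH[OF ternary_sum_eqD(2)[OF Suc.prems]] show ?case by simp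
  qed
  then show "S = T" if "ternary_sum S = ternary_sum T" for S T using that by blast
qed

lemma ternary_sum_le_power:
  assumes "S \<inter> {..<n} = {}"
  shows "ternary_sum S \<le> (1 / 3) ^ n"
  using assms
proof (induction n arbitrary: S)
  case 0
  then show ?case using ternary_sum_le_1 by simp
next
  case (Suc n)
  have "shift_down S \<inter> {..<n} = {}" "0 \<notin> S" using Suc.prems by auto
  then have "ternary_sum S = ternary_sum (shift_down S) / 3"
    by (subst ternary_sum_unfold) simp
  also have "\<dots> \<le> (1 / 3) ^ n / 3"
    using Suc.IH[OF \<open>shift_down S \<inter> {..<n} = {}\<close>] by linarith
  finally show ?case by simp
qed

lemma ternary_sum_pos: "S \<noteq> {} \<Longrightarrow> ternary_sum S > 0"
proof -
  have "ternary_sum {} = 0" by (simp add: ternary_sum_def)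
  then have "S \<noteq> {} \<Longrightarrow> ternary_sum S \<noteq> 0"
    using inj_ternary_sum by (metis injD)
  then show "S \<noteq> {} \<Longrightarrow> ternary_sum S > 0" using ternary_sum_nonneg[of S] by linarith
qed

text \<open>By self-similarity the closure is covered by two copies of itself, each scaled by \<open>1 / 3\<close>.  Its
  measure is finite and at most \<open>2 / 3\<close> of itself, hence \<open>0\<close>.\<close>

lemma negligible_closure_ternary: "negligible (closure (range ternary_sum))"
proof -
  define K where "K = closure (range ternary_sum)"
  define A where "A = (\<lambda>x. (1 / 3) *\<^sub>R x + 0) ` K"
  define B where "B = (+) (2 / 3) ` A"
  have "range ternary_sum \<subseteq> {0..1}"
    using ternary_sum_nonneg ternary_sum_le_1 by auto
  then have "bounded (range ternary_sum)"
    by (rule bounded_subset[OF bounded_closed_interval])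
  then have K: "compact K" by (simp add: K_def compact_closure)
  have A: "compact A"
    unfolding A_def by (rule compact_continuous_image[OF _ K]) (intro continuous_intros)
  have B: "compact B"
    unfolding B_def by (rule compact_continuous_image[OF _ A]) (intro continuous_intros)
  have "range ternary_sum \<subseteq> A \<union> B"
  proof
    fix x assume "x \<in> range ternary_sum"
    then obtain S where x: "x = ternary_sum S" by blast
    have "ternary_sum (shift_down S) \<in> K"
      unfolding K_def by (rule subsetD[OF closure_subset rangeI])
    then have mem: "(1 / 3) *\<^sub>R ternary_sum (shift_down S) + 0 \<in> A"
      unfolding A_def by (rule imageI)
    show "x \<in> A \<union> B"
    proof (cases "0 \<in> S")
      case True
      then have "x = 2 / 3 + ((1 / 3) *\<^sub>R ternary_sum (shift_down S) + 0)"
        unfolding x by (subst ternary_sum_unfold) simp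
      then have "x \<in> B" unfolding B_def using mem by (rule image_eqI)
      then show ?thesis by (rule UnI2)
    next
      case False
      then have "x = (1 / 3) *\<^sub>R ternary_sum (shift_down S) + 0"
        unfolding x by (subst ternary_sum_unfold) simp
      then have "x \<in> A" using mem by (simp only:)
      then show ?thesis by (rule UnI1)
    qed
  qed
  then have "K \<subseteq> A \<union> B"
    unfolding K_def by (rule closure_minimal) (intro closed_Un compact_imp_closed A B)
  then have "measure lebesgue K \<le> measure lebesgue (A \<union> B)"
    by (rule measure_mono_fmeasurable[OF _ fmeasurableD[OF lmeasurable_compact[OF K]]
          lmeasurable_compact[OF compact_Un[OF A B]]])
  moreover have "measure lebesgue (A \<union> B) \<le> measure lebesgue A + measure lebesgue B"
    by (rule measure_Un_le[OF fmeasurableD[OF lmeasurable_compact[OF A]] fmeasurableD[OF lmeasurable_compact[OF B]]])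
  moreover have "measure lebesgue B = measure lebesgue A"
    unfolding B_def by (rule measure_translation)
  moreover have "measure lebesgue A = measure lebesgue K / 3"
    unfolding A_def using measure_lebesgue_affine[of "1 / 3" 0 K] by simp
  ultimately have "measure lebesgue K = 0"
    using measure_nonneg[of lebesgue K] by linarith
  then show ?thesis
    using lmeasurable_compact[OF K] by (simp add: negligible_iff_measure K_def)
qed

section \<open>An independent family of functions recurring at zero\<close>

lemma ex_surj_nat_set_real_sequence: "\<exists>dec :: nat set \<Rightarrow> nat \<Rightarrow> real. surj dec"
proof -
  obtain h :: "nat set \<Rightarrow> real" where h: "surj h"
    using nat_sets_eqpoll_reals by (auto simp: eqpoll_def bij_betw_def)
  have "surj (\<lambda>D i. h {n. prod_encode (i, n) \<in> D})"
  proof (rule surjI)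
    fix q :: "nat \<Rightarrow> real"
    show "(\<lambda>i. h {n. prod_encode (i, n) \<in> {m. snd (prod_decode m) \<in> inv h (q (fst (prod_decode m)))}}) = q"
      using h by (simp add: fun_eq_iff surj_f_inv_f)
  qed
  then show ?thesis by blast
qed

text \<open>For each pair of indices a point is chosen that tells the two sets apart; the pairs are numbered by
  \<open>prod_encode\<close>.\<close>

lemma finite_separating_sequence:
  fixes A :: "nat \<Rightarrow> 'a set"
  assumes "inj_on A {..<N}"
  obtains k :: nat and x :: "nat \<Rightarrow> 'a" where "inj_on (\<lambda>i. {l. l < k \<and> x l \<in> A i}) {..<N}"
proof -
  define x where "x l = (let (i, j) = prod_decode l in SOME y. (y \<in> A i) \<noteq> (y \<in> A j))" for l
  have sep: "(x (prod_encode (i, j)) \<in> A i) \<noteq> (x (prod_encode (i, j)) \<in> A j)" if "A i \<noteq> A j" for i j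
  proof -
    have "\<exists>y. (y \<in> A i) \<noteq> (y \<in> A j)" using that by blast
    from someI_ex[OF this] show ?thesis by (simp add: x_def)
  qed
  have "finite (prod_encode ` ({..<N} \<times> {..<N}))" by simp
  then obtain k where k: "\<And>l. l \<in> prod_encode ` ({..<N} \<times> {..<N}) \<Longrightarrow> l < k"
    unfolding finite_nat_set_iff_bounded by blast
  have "inj_on (\<lambda>i. {l. l < k \<and> x l \<in> A i}) {..<N}"
  proof (rule inj_onI, rule ccontr)
    fix i j assume ij: "i \<in> {..<N}" "j \<in> {..<N}" "{l. l < k \<and> x l \<in> A i} = {l. l < k \<and> x l \<in> A j}" "i \<noteq> j"
    then have "A i \<noteq> A j" using assms by (auto dest: inj_onD)
    moreover have "prod_encode (i, j) < k" using ij by (intro k) auto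
    ultimately show False using sep[of i j] ij(3) by blast
  qed
  then show ?thesis by (rule that)
qed

text \<open>A sequence \<open>q\<close> of reals is read as data: the entry \<open>q 0\<close> gives a number \<open>k\<close>, the odd places give test points \<open>x\<close>,
  and the positive even places give a table of values indexed by codes of subsets of \<open>{..<k}\<close>.  The function belonging to \<open>A\<close> looks up
  the value filed under \<open>{l. l < k \<and> x l \<in> A}\<close>.  Finitely many distinct sets are
  told apart by finitely many test points, so their values can be prescribed independently.\<close>

lemma ex_interpolating_family:
  "\<exists>g :: real set \<Rightarrow> nat set \<Rightarrow> real. (\<forall>A D. 0 \<le> g A D \<and> g A D \<le> 1) \<and>
     (\<forall>(N :: nat) A v. inj_on A {..<N} \<longrightarrow> (\<forall>i<N. 0 \<le> v i \<and> v i \<le> 1) \<longrightarrow> (\<exists>D. \<forall>i<N. g (A i) D = v i))"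
proof -
  obtain dec :: "nat set \<Rightarrow> nat \<Rightarrow> real" where dec: "surj dec"
    using ex_surj_nat_set_real_sequence by blast
  define pat :: "nat \<Rightarrow> (nat \<Rightarrow> real) \<Rightarrow> real set \<Rightarrow> nat"
    where "pat k x A = set_encode {l. l < k \<and> x l \<in> A}" for k x A
  define g0 :: "real set \<Rightarrow> (nat \<Rightarrow> real) \<Rightarrow> real"
    where "g0 A q = max 0 (min 1 (q (2 * pat (nat \<lfloor>q 0\<rfloor>) (\<lambda>l. q (2 * l + 1)) A + 2)))" for A q
  have "\<exists>D. \<forall>i<N. g0 (A i) (dec D) = v i"
    if A: "inj_on A {..<N}" and v: "\<forall>i<N. 0 \<le> v i \<and> v i \<le> 1" for N :: nat and A v
  proof -
    obtain k :: nat and x where sep: "inj_on (\<lambda>i. {l. l < k \<and> x l \<in> A i}) {..<N}"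
      by (rule finite_separating_sequence[OF A]) 
    have inj: "inj_on (\<lambda>i. pat k x (A i)) {..<N}"
    proof (rule inj_onI)
      fix i j assume ij: "i \<in> {..<N}" "j \<in> {..<N}" "pat k x (A i) = pat k x (A j)"
      then have "{l. l < k \<and> x l \<in> A i} = {l. l < k \<and> x l \<in> A j}"
        unfolding pat_def by (simp add: set_encode_eq)
      with sep ij(1,2) show "i = j" by (simp add: inj_onD)
    qed
    define q where "q n = (if n = 0 then real k else if odd n then x (n div 2)
        else v (the_inv_into {..<N} (\<lambda>i. pat k x (A i)) (n div 2 - 1)))" for n
    obtain D where D: "dec D = q" using dec by (metis surjD)
    have "nat \<lfloor>q 0\<rfloor> = k" "(\<lambda>l. q (2 * l + 1)) = x" by (simp_all add: q_def)
    moreover have "q (2 * pat k x (A i) + 2) = v i" if "i < N" for i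
      using the_inv_into_f_f[OF inj, of i] that by (simp add: q_def)
    ultimately have "g0 (A i) q = v i" if "i < N" for i
      using v that by (simp add: g0_def)
    then show ?thesis using D by blast
  qed
  then show ?thesis
    by (intro exI[of _ "\<lambda>A D. g0 A (dec D)"]) (auto simp: g0_def)
qed

text \<open>The digits after the first nonzero one.  This forgets the order of magnitude of a point of the
  Cantor set, so each content occurs at arbitrarily small points.\<close>

definition after_first :: "nat set \<Rightarrow> nat set" where
  "after_first S = {i. Suc (LEAST n. n \<in> S) + i \<in> S}"

lemma ex_after_first:
  "\<exists>S. after_first S = D \<and> S \<noteq> {} \<and> S \<inter> {..<n} = {}"
proof -
  let ?S = "insert n ((+) (Suc n) ` D)"
  have "(LEAST m. m \<in> ?S) = n" by (rule Least_equality) auto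
  then have "after_first ?S = D" by (auto simp: after_first_def)
  then show ?thesis by (intro exI[of _ ?S]) auto
qed

text \<open>The interpolating functions are transplanted to the Cantor set, evaluated at the digits after the
  first nonzero one, and extended evenly and by \<open>0\<close>.  The values at \<open>y\<close> therefore depend only on
  data that occur also at points arbitrarily close to \<open>0\<close>.\<close>

lemma ex_recurrent_interpolating_family:
  obtains Z :: "real set" and G :: "real set \<Rightarrow> real \<Rightarrow> real"
  where "closed Z" "negligible Z" "\<forall>A y. y \<notin> Z \<longrightarrow> G A y = 0"
    and "\<forall>A y. 0 \<le> G A y \<and> G A y \<le> 1"
    and "\<forall>(N :: nat) A v. inj_on A {..<N} \<longrightarrow> (\<forall>i<N. 0 \<le> v i \<and> v i \<le> 1) \<longrightarrow>
           (\<exists>y. \<forall>i<N. G (A i) y = v i)"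
    and "\<forall>y. (\<exists>A. G A y \<noteq> 0) \<longrightarrow>
           (\<forall>\<epsilon>>0. \<exists>y'. 0 < y' \<and> y' < \<epsilon> \<and> (\<forall>A. G A y' = G A y \<and> G A (- y') = G A y))"
proof -
  obtain g :: "real set \<Rightarrow> nat set \<Rightarrow> real"
    where g01: "\<And>A D. 0 \<le> g A D" "\<And>A D. g A D \<le> 1"
      and interpolate: "\<And>(N :: nat) A v. inj_on A {..<N} \<Longrightarrow> (\<And>i. i < N \<Longrightarrow> 0 \<le> v i \<and> v i \<le> 1) \<Longrightarrow>
           \<exists>D. \<forall>i<N. g (A i) D = v i"
    using ex_interpolating_family by metis
  define Z where "Z = closure (range ternary_sum) \<union> uminus ` closure (range ternary_sum)"
  define G where "G A y = (if \<bar>y\<bar> \<in> range ternary_sum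
      then g A (after_first (inv ternary_sum \<bar>y\<bar>)) else 0)" for A y
  have G_ternary: "G A (ternary_sum S) = g A (after_first S)" "G A (- ternary_sum S) = g A (after_first S)" for A S
    using ternary_sum_nonneg[of S] by (simp_all add: G_def inj_ternary_sum)
  have recur: "\<exists>y'. 0 < y' \<and> y' < \<epsilon> \<and> (\<forall>A. G A y' = g A D \<and> G A (- y') = g A D)" if pos: "\<epsilon> > 0" for \<epsilon> D
  proof -
    obtain n where n: "(1 / 3) ^ n < \<epsilon>"
      using real_arch_pow_inv[of \<epsilon> "1 / 3"] pos by auto
    obtain S where S: "after_first S = D" "S \<noteq> {}" "S \<inter> {..<n} = {}"
      using ex_after_first by blast
    show ?thesis
      using S n ternary_sum_pos[OF S(2)] ternary_sum_le_power[OF S(3)]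
      by (intro exI[of _ "ternary_sum S"]) (simp add: G_ternary)
  qed
  show ?thesis
  proof (rule that[of Z G])
    show "closed Z"
      unfolding Z_def by (intro closed_Un closed_closure closed_negations)
    have "negligible (uminus ` closure (range ternary_sum))"
      by (rule negligible_locally_Lipschitz_image[OF order_refl negligible_closure_ternary])
         (rule exI[of _ UNIV], rule exI[of _ 1], simp add: abs_minus_commute)
    then show "negligible Z"
      unfolding Z_def by (intro negligible_Un negligible_closure_ternary)
    show "\<forall>A y. y \<notin> Z \<longrightarrow> G A y = 0"
    proof (intro allI impI)
      fix A y assume "y \<notin> Z"
      have "\<bar>y\<bar> \<notin> range ternary_sum"
      proof
        assume "\<bar>y\<bar> \<in> range ternary_sum"
        then have y: "\<bar>y\<bar> \<in> closure (range ternary_sum)" by (rule subsetD[OF closure_subset])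
        then have "- \<bar>y\<bar> \<in> uminus ` closure (range ternary_sum)" by (rule imageI)
        then show False using y \<open>y \<notin> Z\<close> by (cases "y \<ge> 0") (auto simp: Z_def)
      qed
      then show "G A y = 0" by (simp add: G_def)
    qed
    show "\<forall>A y. 0 \<le> G A y \<and> G A y \<le> 1" by (simp add: G_def g01)
    show "\<forall>(N :: nat) A v. inj_on A {..<N} \<longrightarrow> (\<forall>i<N. 0 \<le> v i \<and> v i \<le> 1) \<longrightarrow>
        (\<exists>y. \<forall>i<N. G (A i) y = v i)"
    proof (intro allI impI)
      fix N :: nat and A :: "nat \<Rightarrow> real set" and v :: "nat \<Rightarrow> real"
      assume Av: "inj_on A {..<N}" "\<forall>i<N. 0 \<le> v i \<and> v i \<le> 1"
      obtain D where D: "\<And>i. i < N \<Longrightarrow> g (A i) D = v i"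
        using interpolate[OF Av(1), of v] Av(2) by blast
      obtain y where "\<forall>A. G A y = g A D"
        using recur[of 1 D] by auto
      then have "\<forall>i<N. G (A i) y = v i" using D by simp
      then show "\<exists>y. \<forall>i<N. G (A i) y = v i" by blast
    qed
    show "\<forall>y. (\<exists>A. G A y \<noteq> 0) \<longrightarrow>
           (\<forall>\<epsilon>>0. \<exists>y'. 0 < y' \<and> y' < \<epsilon> \<and> (\<forall>A. G A y' = G A y \<and> G A (- y') = G A y))"
    proof (intro allI impI)
      fix y \<epsilon> :: real assume y: "\<exists>A. G A y \<noteq> 0" and \<epsilon>: "\<epsilon> > 0"
      have "\<bar>y\<bar> \<in> range ternary_sum" using y by (auto simp: G_def split: if_splits)
      then have "G A y = g A (after_first (inv ternary_sum \<bar>y\<bar>))" for A by (simp add: G_def)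
      then show "\<exists>y'. 0 < y' \<and> y' < \<epsilon> \<and> (\<forall>A. G A y' = G A y \<and> G A (- y') = G A y)"
        using recur[OF \<epsilon>] by simp
    qed
  qed
qed

section \<open>Oscillation of the composite functions\<close>

text \<open>The rationals are null, so some open set of measure below \<open>1 / 2\<close> contains them; \<open>E\<close> is what it
  leaves of the unit interval.\<close>

lemma ex_fat_nowhere_dense_set:
  obtains E :: "real set" where "closed E" "E \<subseteq> {0..1}" "E \<inter> \<rat> = {}"
    "E \<in> lmeasurable" "measure lebesgue E > 0"
proof -
  have Q: "negligible (\<rat> :: real set)"
    unfolding negligible_iff_null_sets
    by (rule null_sets_completionI[OF countable_imp_null_set_lborel[OF countable_rat]])
  have half: "(0 :: real) < 1 / 2" by simp
  obtain U :: "real set" where U: "open U" "\<rat> \<subseteq> U" "U - \<rat> \<in> lmeasurable" "emeasure lebesgue (U - \<rat>) < ennreal (1 / 2)"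
    by (rule sets_lebesgue_outer_open[OF negligible_imp_sets[OF Q] half]) 
  define E where "E = {0..1} - U"
  have E: "compact E"
    unfolding E_def using U(1) by (intro compact_diff compact_Icc)
  have small: "measure lebesgue (U - \<rat>) < 1 / 2"
    using U(4) unfolding emeasure_eq_measure2[OF U(3)]
    by (simp add: ennreal_less_iff del: ennreal_half)
  note Em = lmeasurable_compact[OF E] and Qm = negligible_imp_measurable[OF Q]
  note Um = fmeasurable.Un[OF U(3) Qm]
  have "{0..1} \<subseteq> E \<union> ((U - \<rat>) \<union> \<rat>)" by (auto simp: E_def)
  then have "measure lebesgue {0..1::real} \<le> measure lebesgue (E \<union> ((U - \<rat>) \<union> \<rat>))"
    by (rule measure_mono_fmeasurable[OF _ _ fmeasurable.Un[OF Em Um]]) simp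
  moreover have "measure lebesgue (E \<union> ((U - \<rat>) \<union> \<rat>))
      \<le> measure lebesgue E + measure lebesgue ((U - \<rat>) \<union> \<rat>)"
    by (rule measure_Un_le[OF fmeasurableD[OF Em] fmeasurableD[OF Um]])
  moreover have "measure lebesgue ((U - \<rat>) \<union> \<rat>) \<le> measure lebesgue (U - \<rat>) + measure lebesgue (\<rat> :: real set)"
    by (rule measure_Un_le[OF fmeasurableD[OF U(3)] fmeasurableD[OF Qm]])
  moreover have "measure lebesgue (\<rat> :: real set) = 0"
    by (rule negligible_imp_measure0[OF Q])
  moreover have "measure lebesgue {0..1::real} = 1" by simp
  ultimately have "measure lebesgue E > 0" using small by linarith
  moreover have "E \<subseteq> {0..1}" "E \<inter> \<rat> = {}" using U(2) by (auto simp: E_def)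
  ultimately show ?thesis using that[OF compact_imp_closed[OF E]] Em by blast
qed

lemma negligible_misses_interval:
  fixes p q :: real
  assumes "negligible Z" "p < q"
  obtains z where "p < z" "z < q" "z \<notin> Z"
proof -
  have "\<not> negligible {p<..<q}"
    using open_not_negligible[of "{p<..<q}"] assms(2) by simp
  then have "\<exists>z\<in>{p<..<q}. z \<notin> Z" using assms(1) negligible_subset by blast
  then show ?thesis using that by auto
qed

lemma infdist_attains_smaller:
  fixes u v :: real
  assumes "x \<in> E" "x \<in> {u..v}" "q \<in> {u..v}" "0 \<le> s" "s \<le> infdist q E"
  shows "\<exists>w\<in>{u..v}. infdist w E = s"
proof -
  have "connected ((\<lambda>x. infdist x E) ` {u..v})"
    by (intro connected_continuous_image continuous_intros connected_Icc)
  moreover have "0 \<in> (\<lambda>x. infdist x E) ` {u..v}" by (rule image_eqI[of _ _ x]) (use assms in auto)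
  moreover have "infdist q E \<in> (\<lambda>x. infdist x E) ` {u..v}" by (rule imageI) (rule assms)
  ultimately have "{0..infdist q E} \<subseteq> (\<lambda>x. infdist x E) ` {u..v}"
    by (rule connected_contains_Icc)
  moreover have "s \<in> {0..infdist q E}" using assms by simp
  ultimately have "s \<in> (\<lambda>x. infdist x E) ` {u..v}" by blast
  then show ?thesis by auto
qed

text \<open>A rational \<open>q\<close> in the interval lies outside \<open>E\<close>.  Between \<open>q\<close> and a point of \<open>E\<close> the distance to \<open>E\<close> passes
  through all small positive numbers, so \<open>\<Phi> (infdist x E)\<close> takes a nonzero value \<open>m\<close>, and with it all values
  between \<open>0\<close> and \<open>m\<close>.  Of these, some point \<open>y\<close> or \<open>- y\<close> has \<open>r\<close>-value \<open>a\<close>, and some point off \<open>Z\<close> has \<open>r\<close>-value \<open>0\<close>.\<close>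

lemma composite_oscillates:
  fixes u v :: real
  assumes E: "closed E" "E \<inter> \<rat> = {}"
    and \<Phi>: "continuous_on {0..} \<Phi>" "\<Phi> 0 = (0 :: real)" "\<forall>\<^sub>F s in at_right 0. \<Phi> s \<noteq> 0"
    and Z: "negligible Z" "\<And>y. y \<notin> Z \<Longrightarrow> r y = 0"
    and recur: "\<And>\<epsilon>. \<epsilon> > 0 \<Longrightarrow> \<exists>y. 0 < y \<and> y < \<epsilon> \<and> r y = a \<and> r (- y) = a"
    and uv: "{u<..<v} \<inter> E \<noteq> {}"
  shows "(\<exists>x\<in>{u..v}. r (\<Phi> (infdist x E)) = a) \<and> (\<exists>x\<in>{u..v}. r (\<Phi> (infdist x E)) = 0)"
proof -
  obtain x where x: "u < x" "x < v" "x \<in> E" using uv by auto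
  then have "E \<noteq> {}" by blast
  obtain q where q: "q \<in> \<rat>" "u < q" "q < v" using Rats_dense_in_real[of u v] x by auto
  then have "q \<notin> E" using E(2) by blast
  then have pos: "infdist q E > 0"
    using E(1) \<open>E \<noteq> {}\<close> by (simp add: infdist_pos_not_in_closed)
  have x0: "infdist x E = 0" using x(3) by simp
  obtain b where b: "b > 0" "\<And>s. 0 < s \<Longrightarrow> s < b \<Longrightarrow> \<Phi> s \<noteq> 0"
    using \<Phi>(3) by (auto simp: eventually_at_right_field)
  define s where "s = min (infdist q E) (b / 2)"
  have s: "0 < s" "s < b" "s \<le> infdist q E" using pos b(1) by (auto simp: s_def)
  have "\<exists>w\<in>{u..v}. infdist w E = s"
    by (rule infdist_attains_smaller[of x E u v q]) (use x q s in auto)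
  then obtain w where w: "w \<in> {u..v}" "infdist w E = s" by blast
  define m where "m = \<Phi> (infdist w E)"
  have "m \<noteq> 0" using b(2) s w(2) by (simp add: m_def)
  let ?c = "\<lambda>x. \<Phi> (infdist x E)"
  have "continuous_on {u..v} ?c"
    by (rule continuous_on_compose2[OF \<Phi>(1)]) (auto intro!: continuous_intros infdist_nonneg)
  then have conn: "connected (?c ` {u..v})"
    by (intro connected_continuous_image connected_Icc)
  have zero: "0 \<in> ?c ` {u..v}" by (rule image_eqI[of _ _ x]) (use x x0 \<Phi>(2) in auto)
  have m: "m \<in> ?c ` {u..v}" unfolding m_def by (rule imageI) (rule w(1))
  obtain y where y: "0 < y" "y < \<bar>m\<bar>" "r y = a" "r (- y) = a"
    using recur[of "\<bar>m\<bar>"] \<open>m \<noteq> 0\<close> by auto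
  have "\<exists>p\<in>?c ` {u..v}. r p = a \<and> (\<exists>z\<in>?c ` {u..v}. r z = 0)"
  proof (cases "m > 0")
    case True
    have sub: "{0..m} \<subseteq> ?c ` {u..v}" by (rule connected_contains_Icc[OF conn zero m])
    obtain z where "0 < z" "z < m" "z \<notin> Z" using negligible_misses_interval[OF Z(1) True] by blast
    then have "z \<in> {0..m}" "r z = 0" using Z(2) by auto
    moreover have "y \<in> {0..m}" using y True by auto
    ultimately show ?thesis using sub y(3) by blast
  next
    case False
    then have neg: "m < 0" using \<open>m \<noteq> 0\<close> by simp
    have sub: "{m..0} \<subseteq> ?c ` {u..v}" by (rule connected_contains_Icc[OF conn m zero])
    obtain z where "m < z" "z < 0" "z \<notin> Z" using negligible_misses_interval[OF Z(1) neg] by blast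
    then have "z \<in> {m..0}" "r z = 0" using Z(2) by auto
    moreover have "- y \<in> {m..0}" using y neg by auto
    ultimately show ?thesis using sub y(4) by blast
  qed
  then show ?thesis by blast
qed

section \<open>The two free algebras\<close>

theorem theorem2p5:
  "\<exists>(S :: (real \<Rightarrow> real) set) (C :: (real \<Rightarrow> real) set).
     free_function_algebra (UNIV :: real set) (UNIV :: real set set) S \<and>
     (\<forall>r\<in>S. \<forall>\<alpha> \<beta>. \<alpha> \<le> \<beta> \<longrightarrow> riemann_integrable r \<alpha> \<beta>) \<and>
     free_function_algebra {0..1 :: real} (UNIV :: real set) C \<and>
     (\<forall>c\<in>C. continuous_on {0..1} c) \<and>
     (\<forall>r \<in> S - {\<lambda>x. 0}. \<forall>c \<in> C - {\<lambda>x\<in>{0..1}. 0}.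
        \<not> riemann_integrable (r \<circ> c) 0 1)"
proof -
  obtain Z :: "real set" and G :: "real set \<Rightarrow> real \<Rightarrow> real"
    where Z: "closed Z" "negligible Z" and G_off: "\<forall>A y. y \<notin> Z \<longrightarrow> G A y = 0"
      and G01: "\<forall>A y. 0 \<le> G A y \<and> G A y \<le> 1"
      and interpolate: "\<forall>(N :: nat) A v. inj_on A {..<N} \<longrightarrow> (\<forall>i<N. 0 \<le> v i \<and> v i \<le> 1) \<longrightarrow>
           (\<exists>y. \<forall>i<N. G (A i) y = v i)"
      and recur: "\<forall>y. (\<exists>A. G A y \<noteq> 0) \<longrightarrow>
           (\<forall>\<epsilon>>0. \<exists>y'. 0 < y' \<and> y' < \<epsilon> \<and> (\<forall>A. G A y' = G A y \<and> G A (- y') = G A y))"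
    by (rule ex_recurrent_interpolating_family)
  have interpolation: "\<exists>y. \<forall>i<N. G (A i) y = v i"
    if "inj_on A {..<N}" "\<forall>i<N. 0 \<le> v i \<and> v i \<le> 1" for N :: nat and A v
    by (rule interpolate[THEN spec, THEN spec, THEN spec, THEN mp, THEN mp, OF that])
  obtain E :: "real set" where E: "closed E" "E \<subseteq> {0..1}" "E \<inter> \<rat> = {}"
      "E \<in> lmeasurable" "measure lebesgue E > 0"
    by (rule ex_fat_nowhere_dense_set)
  have "E \<noteq> {}" using E(5) by auto
  define H where "H \<tau> = (\<lambda>x\<in>{0..1::real}. flat_exp \<tau> (infdist x E))" for \<tau>
  let ?S = "polynomial_algebra UNIV (range G)" and ?C = "polynomial_algebra {0..1} (range H)"

  have S_free: "free_function_algebra UNIV (UNIV :: real set set) ?S"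
  proof (rule free_function_algebra_polynomial_algebra)
    \<comment> \<open>Two distinct sets can be given the values \<open>0\<close> and \<open>1\<close> at one point.\<close>
    show "inj G"
    proof (rule injI, rule ccontr)
      fix A B assume AB: "G A = G B" "A \<noteq> B"
      let ?A = "\<lambda>i::nat. if i = 0 then A else B" and ?v = "\<lambda>i::nat. if i = 0 then 0 else 1 :: real"
      have "inj_on ?A {..<2}"
        using AB(2) by (auto simp: inj_on_def less_2_cases_iff)
      moreover have "\<forall>i<2. 0 \<le> ?v i \<and> ?v i \<le> 1" by simp
      ultimately have "\<exists>y. \<forall>i<2. G (?A i) y = ?v i" by (rule interpolation)
      then obtain y where y: "\<forall>i<2. G (?A i) y = ?v i" ..
      have "G A y = 0" "G B y = 1"
        using y[rule_format, of 0] y[rule_format, of 1] by simp_all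
      then show False using AB(1) by simp
    qed
    show "range G \<subseteq> extensional UNIV" by (simp add: extensional_def)
    show "\<exists>x\<in>UNIV. mpoly_eval P (\<lambda>i. G (t i) x) \<noteq> 0"
      if P: "P \<in> mpolys_no_const N" "P \<noteq> 0" and t: "inj_on t {..<N}" for N P t
    proof -
      \<comment> \<open>The flat functions also provide a point of the unit cube at which \<open>P\<close> does not vanish; the
        generators attain these coordinates together.\<close>
      have "\<forall>\<^sub>F s in at_right 0. mpoly_eval P (\<lambda>i. flat_exp (real i) s) \<noteq> 0"
        by (rule flat_exp_independent[OF P]) (simp add: inj_on_def)
      then obtain s where s: "mpoly_eval P (\<lambda>i. flat_exp (real i) s) \<noteq> 0"
        using eventually_happens'[OF trivial_limit_at_right_real] by blast
      have "\<exists>y. \<forall>i<N. G (t i) y = flat_exp (real i) s"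
        by (rule interpolation[OF t]) (simp add: flat_exp_bounds)
      then obtain y where y: "\<forall>i<N. G (t i) y = flat_exp (real i) s" ..
      have "mpoly_eval P (\<lambda>i. G (t i) y) = mpoly_eval P (\<lambda>i. flat_exp (real i) s)"
        by (rule mpoly_eval_cong[OF P(1)]) (simp add: y)
      then show ?thesis using s by (intro bexI[of _ y]) simp_all
    qed
  qed

  have S_form: "\<exists>N P t. P \<in> mpolys_no_const N \<and> r = (\<lambda>y. mpoly_eval P (\<lambda>i. G (t i) y))" if "r \<in> ?S" for r
  proof -
    obtain N P f where P: "P \<in> mpolys_no_const N" "f ` {..<N} \<subseteq> range G" "r = mpoly_of_functions UNIV P f"
      using \<open>r \<in> ?S\<close> by (auto simp: polynomial_algebra_def)
    have "\<forall>i\<in>{..<N}. \<exists>A. f i = G A" using P(2) by blast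
    then obtain t where t: "\<And>i. i < N \<Longrightarrow> f i = G (t i)" by (metis lessThan_iff)
    have "r y = mpoly_eval P (\<lambda>i. G (t i) y)" for y
      unfolding P(3) mpoly_of_functions_def restrict_UNIV by (rule mpoly_eval_cong[OF P(1)]) (simp add: t)
    then show ?thesis using P(1) by blast
  qed

  have S_zero: "r y = 0" if "r \<in> ?S" "y \<notin> Z" for r y
  proof -
    obtain N P t where P: "P \<in> mpolys_no_const N" "r = (\<lambda>y. mpoly_eval P (\<lambda>i. G (t i) y))"
      using S_form[OF \<open>r \<in> ?S\<close>] by blast
    show ?thesis
      unfolding P(2) by (rule mpoly_eval_zero_arguments[OF P(1)]) (simp add: G_off \<open>y \<notin> Z\<close>)
  qed

  have S_integrable: "riemann_integrable r \<alpha> \<beta>" if r: "r \<in> ?S" for r \<alpha> \<beta>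
  proof -
    obtain N P t where P: "P \<in> mpolys_no_const N" "r = (\<lambda>y. mpoly_eval P (\<lambda>i. G (t i) y))"
      using S_form[OF r] by blast
    have "\<bar>r y\<bar> \<le> (\<Sum>m\<in>Poly_Mapping.keys P. \<bar>Poly_Mapping.lookup P m\<bar>)" for y
      unfolding P(2) by (rule mpoly_eval_bound[OF P(1)]) (simp add: G01)
    then show ?thesis
      by (rule riemann_integrable_zero_off_closed_null[OF Z(1,2)]) (rule S_zero[OF r])
  qed

  have S_recur: "\<exists>y. 0 < y \<and> y < \<epsilon> \<and> r y = r y0 \<and> r (- y) = r y0"
    if r: "r \<in> ?S" "r y0 \<noteq> 0" and \<epsilon>: "\<epsilon> > 0" for r y0 \<epsilon>
  proof -
    obtain N P t where P: "P \<in> mpolys_no_const N" "r = (\<lambda>y. mpoly_eval P (\<lambda>i. G (t i) y))"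
      using S_form[OF r(1)] by blast
    \<comment> \<open>A polynomial without constant term vanishes where all generators vanish.\<close>
    have "\<exists>A. G A y0 \<noteq> 0"
      using r(2) mpoly_eval_zero_arguments[OF P(1), of "\<lambda>i. G (t i) y0"] unfolding P(2) by blast
    from recur[rule_format, OF this \<epsilon>]
    obtain y where "0 < y" "y < \<epsilon>" "\<forall>A. G A y = G A y0 \<and> G A (- y) = G A y0"
      by blast
    then show ?thesis unfolding P(2) by auto
  qed

  have C_form: "\<exists>N P t. P \<in> mpolys_no_const N \<and> inj_on t {..<N} \<and>
      c = (\<lambda>x\<in>{0..1}. mpoly_eval P (\<lambda>i. flat_exp (t i) (infdist x E)))" if "c \<in> ?C" for c
  proof -
    obtain N P f where P: "P \<in> mpolys_no_const N" "f ` {..<N} \<subseteq> range H" "inj_on f {..<N}"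
        "c = mpoly_of_functions {0..1} P f"
      using \<open>c \<in> ?C\<close> by (auto simp: polynomial_algebra_def)
    have "\<forall>i\<in>{..<N}. \<exists>\<tau>. f i = H \<tau>" using P(2) by blast
    then obtain t where t: "\<And>i. i < N \<Longrightarrow> f i = H (t i)" by (metis lessThan_iff)
    have "inj_on t {..<N}"
    proof (rule inj_onI)
      fix i j assume "i \<in> {..<N}" "j \<in> {..<N}" "t i = t j"
      then show "i = j" using t[of i] t[of j] inj_onD[OF P(3), of i j] by simp
    qed
    moreover have "c = (\<lambda>x\<in>{0..1}. mpoly_eval P (\<lambda>i. flat_exp (t i) (infdist x E)))"
      unfolding P(4) mpoly_of_functions_def
      by (intro restrict_ext mpoly_eval_cong[OF P(1)]) (simp add: t H_def)
    ultimately show ?thesis using P(1) by blast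
  qed

  have cont: "continuous_on {0..} (\<lambda>s. mpoly_eval P (\<lambda>i. flat_exp (t i) s))"
    if "P \<in> mpolys_no_const N" for P N t
    by (rule continuous_on_mpoly_eval[OF that continuous_on_flat_exp])

  \<comment> \<open>Every small positive number is a distance to \<open>E\<close>, so inequalities between the flat functions near \<open>0\<close>
    are inequalities between the generators.\<close>
  have small: "\<exists>x\<in>{0..1}. infdist x E = s" if "0 < s" "s < infdist 0 E" for s
  proof -
    obtain e where e: "e \<in> E" using \<open>E \<noteq> {}\<close> by blast
    then have e01: "e \<in> {0..1}" using E(2) by blast
    show ?thesis
      by (rule infdist_attains_smaller[OF e, of 0 1 0]) (use e01 that in auto)
  qed
  have "0 \<notin> E" using E(3) by auto
  then have dist0: "infdist 0 E > 0"
    using E(1) \<open>E \<noteq> {}\<close> by (simp add: infdist_pos_not_in_closed)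

  have C_free: "free_function_algebra {0..1} (UNIV :: real set) ?C"
  proof (rule free_function_algebra_polynomial_algebra)
    show "inj H"
    proof (rule injI, rule ccontr)
      fix \<sigma> \<tau> assume *: "H \<sigma> = H \<tau>" "\<sigma> \<noteq> \<tau>"
      obtain s where s: "0 < s" "s < infdist 0 E" "s < 1"
        using dist0 dense[of 0 "min 1 (infdist 0 E)"] by auto
      obtain x where x: "x \<in> {0..1}" "infdist x E = s" using small[OF s(1,2)] by blast
      have "flat_exp \<sigma> s = flat_exp \<tau> s"
        using fun_cong[OF *(1), of x] x by (simp add: H_def)
      then show False using flat_exp_separates[OF *(2) s(1,3)] by blast
    qed
    show "range H \<subseteq> extensional {0..1}" by (auto simp: H_def)
    show "\<exists>x\<in>{0..1}. mpoly_eval P (\<lambda>i. H (t i) x) \<noteq> 0"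
      if P: "P \<in> mpolys_no_const N" "P \<noteq> 0" and t: "inj_on t {..<N}" for N P t
    proof -
      obtain b where b: "b > 0" "\<And>s. 0 < s \<Longrightarrow> s < b \<Longrightarrow> mpoly_eval P (\<lambda>i. flat_exp (t i) s) \<noteq> 0"
        using flat_exp_independent[OF P t] by (auto simp: eventually_at_right_field)
      obtain s where s: "0 < s" "s < infdist 0 E" "s < b"
        using dist0 b(1) dense[of 0 "min b (infdist 0 E)"] by auto
      obtain x where x: "x \<in> {0..1}" "infdist x E = s" using small[OF s(1,2)] by blast
      have "mpoly_eval P (\<lambda>i. H (t i) x) = mpoly_eval P (\<lambda>i. flat_exp (t i) s)"
        using x by (simp add: H_def)
      then show ?thesis using b(2)[OF s(1,3)] x(1) by (intro bexI[of _ x]) simp_all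
    qed
  qed

  have C_cont: "continuous_on {0..1} c" if "c \<in> ?C" for c
  proof -
    obtain N P t where P: "P \<in> mpolys_no_const N"
        "c = (\<lambda>x\<in>{0..1}. mpoly_eval P (\<lambda>i. flat_exp (t i) (infdist x E)))"
      using C_form[OF \<open>c \<in> ?C\<close>] by blast
    have "continuous_on {0..1} (\<lambda>x. mpoly_eval P (\<lambda>i. flat_exp (t i) (infdist x E)))"
      by (rule continuous_on_compose2[OF cont[OF P(1)]]) (auto intro!: continuous_intros infdist_nonneg)
    then show ?thesis unfolding P(2) by (rule continuous_on_eq) simp
  qed

  have bad: "\<not> riemann_integrable (r \<circ> c) 0 1"
    if r: "r \<in> ?S" "r \<noteq> (\<lambda>x. 0)" and c: "c \<in> ?C" "c \<noteq> (\<lambda>x\<in>{0..1}. 0)" for r c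
  proof -
    obtain y0 where y0: "r y0 \<noteq> 0" using r(2) by auto
    obtain N P t where P: "P \<in> mpolys_no_const N" and t: "inj_on t {..<N}"
        and c_eq: "c = (\<lambda>x\<in>{0..1}. mpoly_eval P (\<lambda>i. flat_exp (t i) (infdist x E)))"
      using C_form[OF c(1)] by blast
    have "P \<noteq> 0" using c(2) c_eq by auto
    note osc = composite_oscillates[OF E(1,3) cont[OF P], of t Z r "r y0",
        OF mpoly_eval_zero_arguments[OF P] flat_exp_independent[OF P \<open>P \<noteq> 0\<close> t] Z(2) S_zero[OF r(1)] S_recur[OF r(1) y0]]
    show ?thesis
    proof (rule oscillating_not_riemann_integrable[OF E(4,5,2) y0])
      fix u v :: real assume uv: "{u..v} \<subseteq> {0..1}" "{u<..<v} \<inter> E \<noteq> {}"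
      have "(r \<circ> c) x = r (mpoly_eval P (\<lambda>i. flat_exp (t i) (infdist x E)))" if "x \<in> {u..v}" for x
        using uv(1) that by (auto simp: c_eq)
      then show "(\<exists>x\<in>{u..v}. (r \<circ> c) x = r y0) \<and> (\<exists>x\<in>{u..v}. (r \<circ> c) x = 0)"
        using osc[of u v] uv(2) by (simp add: flat_exp_def)
    qed
  qed
  show ?thesis
    by (intro exI[of _ ?S] exI[of _ ?C] conjI ballI allI impI S_free C_free S_integrable C_cont bad) auto
qed

end
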